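(* Let $(R,\mathfrak m)$ be a commutative Noetherian local ring, and let $M,N$ be finitely generated $R$-modules with $M\in\Omega\operatorname{Deep}(R)$ and $N\in\operatorname{DF}(R)$. (1) If there is a surjective $R$-homomorphism $M\twoheadrightarrow N$, then $R$ is a direct summand of $M$. (2) If there is an exact sequence $0\to N\to M\to X\to 0$ with $X\in\operatorname{Deep}(R)$, then $R$ is a direct summand of $M$.
   Context: All modules are finitely generated. For a Noetherian local ring $R$ with $\operatorname{depth} R=t$: - $\operatorname{Deep}(R)$ is the class of $R$-modules $X$ with $\operatorname{depth} X\ge t$ (the zero module has depth $\infty$). - $\Omega\operatorname{Deep}(R)$ is the class of $R$-modules $M$ for which there is an exact sequence $0\to M\to R^n\to X\to 0$ with $n\in\mathbb N$ and $X\in\operatorname{Deep}(R)$. - $\operatorname{DF}(R)$ is the class of $R$-modules $M$ for which there is an exact sequence $0\to R\to M^n\to X\to 0$ with $n\in\mathbb N$ and $X\in\operatorname{Deep}(R)$. *)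

theory Defs
  imports "HOL-Algebra.Module" "HOL-Algebra.Ring_Divisibility" "HOL-Library.Extended_Nat"
begin

locale noetherian_local_ring = cring R + noetherian_ring R for R (structure) and \<mm> +
  assumes max_ideal: "maximalideal \<mm> R"
    and max_ideal_unique: "maximalideal J R \<Longrightarrow> J = \<mm>"

definition fg_module :: "('a, 'k) ring_scheme \<Rightarrow> ('a, 'm, 'c) module_scheme \<Rightarrow> bool" where
  "fg_module R M \<longleftrightarrow> module R M \<and>
     (\<exists>A \<subseteq> carrier M. finite A \<and> (\<forall>H. submodule H R M \<longrightarrow> A \<subseteq> H \<longrightarrow> H = carrier M))"

definition mod_hom ::
  "('a, 'k) ring_scheme \<Rightarrow> ('a, 'm, 'c) module_scheme \<Rightarrow> ('a, 'n, 'd) module_scheme \<Rightarrow> ('m \<Rightarrow> 'n) set"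
  where
  "mod_hom R M N = {f \<in> hom (add_monoid M) (add_monoid N).
     \<forall>a \<in> carrier R. \<forall>x \<in> carrier M. f (a \<odot>\<^bsub>M\<^esub> x) = a \<odot>\<^bsub>N\<^esub> f x}"

definition mod_iso ::
  "('a, 'k) ring_scheme \<Rightarrow> ('a, 'm, 'c) module_scheme \<Rightarrow> ('a, 'n, 'd) module_scheme \<Rightarrow> ('m \<Rightarrow> 'n) set"
  where
  "mod_iso R M N = {f \<in> mod_hom R M N. bij_betw f (carrier M) (carrier N)}"

definition short_exact ::
  "('a, 'k) ring_scheme \<Rightarrow> ('a, 'l, 'b) module_scheme \<Rightarrow> ('a, 'm, 'c) module_scheme \<Rightarrow>
     ('a, 'n, 'd) module_scheme \<Rightarrow> ('l \<Rightarrow> 'm) \<Rightarrow> ('m \<Rightarrow> 'n) \<Rightarrow> bool"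
  where
  "short_exact R L M N f g \<longleftrightarrow>
     f \<in> mod_hom R L M \<and> g \<in> mod_hom R M N \<and>
     inj_on f (carrier L) \<and> f ` carrier L = a_kernel M N g \<and> g ` carrier M = carrier N"

text \<open>The record type of modules extends that of rings; the ring multiplication and unit of a
  module play no role in the locale \<^locale>\<open>module\<close> and are arbitrary below.\<close>

definition regular_module :: "('a, 'k) ring_scheme \<Rightarrow> ('a, 'a) module" where
  "regular_module R = \<lparr>carrier = carrier R, monoid.mult = monoid.mult R, one = \<one>\<^bsub>R\<^esub>,
     zero = \<zero>\<^bsub>R\<^esub>, add = add R, smult = monoid.mult R\<rparr>"

definition power_module :: "('a, 'm, 'c) module_scheme \<Rightarrow> nat \<Rightarrow> ('a, nat \<Rightarrow> 'm) module" where
  "power_module M n = \<lparr>carrier = ({..<n} \<rightarrow>\<^sub>E carrier M), monoid.mult = undefined, one = undefined,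
     zero = (\<lambda>i\<in>{..<n}. \<zero>\<^bsub>M\<^esub>),
     add = (\<lambda>u v. \<lambda>i\<in>{..<n}. u i \<oplus>\<^bsub>M\<^esub> v i),
     smult = (\<lambda>a u. \<lambda>i\<in>{..<n}. a \<odot>\<^bsub>M\<^esub> u i)\<rparr>"

definition direct_summand ::
  "('a, 'k) ring_scheme \<Rightarrow> ('a, 'p, 'c) module_scheme \<Rightarrow> ('a, 'm, 'd) module_scheme \<Rightarrow> bool" where
  "direct_summand R P M \<longleftrightarrow> (\<exists>A B. submodule A R M \<and> submodule B R M \<and>
     A \<inter> B = {\<zero>\<^bsub>M\<^esub>} \<and> A <+>\<^bsub>M\<^esub> B = carrier M \<and>
     mod_iso R P (M\<lparr>carrier := A\<rparr>) \<noteq> {})"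

text \<open>\<open>seq_smult M [x\<^sub>1, \<dots>, x\<^sub>n]\<close> is the submodule
  \<open>(x\<^sub>1, \<dots>, x\<^sub>n)M = x\<^sub>1M + \<dots> + x\<^sub>nM\<close>.\<close>

primrec seq_smult :: "('a, 'm, 'c) module_scheme \<Rightarrow> 'a list \<Rightarrow> 'm set" where
  "seq_smult M [] = {\<zero>\<^bsub>M\<^esub>}"
| "seq_smult M (x # xs) = ((\<lambda>u. x \<odot>\<^bsub>M\<^esub> u) ` carrier M) <+>\<^bsub>M\<^esub> seq_smult M xs"

text \<open>The first condition says that multiplication by \<open>x\<^sub>i\<close> is injective on
  \<open>M / (x\<^sub>1, \<dots>, x\<^sub>i\<^sub>-\<^sub>1)M\<close>, the second that \<open>M / (x\<^sub>1, \<dots>, x\<^sub>n)M\<close> is nonzero.\<close>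

definition regular_seq :: "('a, 'm, 'c) module_scheme \<Rightarrow> 'a list \<Rightarrow> bool" where
  "regular_seq M xs \<longleftrightarrow>
     (\<forall>i < length xs. \<forall>u \<in> carrier M.
        (xs ! i) \<odot>\<^bsub>M\<^esub> u \<in> seq_smult M (take i xs) \<longrightarrow> u \<in> seq_smult M (take i xs)) \<and>
     seq_smult M xs \<noteq> carrier M"

definition depth :: "'a set \<Rightarrow> ('a, 'm, 'c) module_scheme \<Rightarrow> enat" where
  "depth \<mm> M = (if carrier M = {\<zero>\<^bsub>M\<^esub>} then \<infinity>
     else Sup {enat (length xs) |xs. set xs \<subseteq> \<mm> \<and> regular_seq M xs})"

definition Deep :: "('a, 'k) ring_scheme \<Rightarrow> 'a set \<Rightarrow> ('a, 'm, 'c) module_scheme \<Rightarrow> bool" where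
  "Deep R \<mm> X \<longleftrightarrow> fg_module R X \<and> depth \<mm> (regular_module R) \<le> depth \<mm> X"

text \<open>Types cannot be quantified existentially, so the cokernels \<open>X\<close> below are taken on the
  types \<open>(nat \<Rightarrow> 'a) set\<close> and \<open>(nat \<Rightarrow> 'm) set\<close> of sets of elements of the middle term. This is
  no restriction, as \<open>X\<close> is isomorphic to a quotient of the middle term, whose elements are
  cosets; see \<open>Omega_DeepI\<close> and \<open>DFI\<close>.\<close>

definition Omega_Deep :: "('a, 'k) ring_scheme \<Rightarrow> 'a set \<Rightarrow> ('a, 'm, 'c) module_scheme \<Rightarrow> bool"
  where
  "Omega_Deep R \<mm> M \<longleftrightarrow> fg_module R M \<and>
     (\<exists>n f g (X :: ('a, (nat \<Rightarrow> 'a) set) module).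
        Deep R \<mm> X \<and> short_exact R M (power_module (regular_module R) n) X f g)"

definition DF :: "('a, 'k) ring_scheme \<Rightarrow> 'a set \<Rightarrow> ('a, 'm, 'c) module_scheme \<Rightarrow> bool" where
  "DF R \<mm> M \<longleftrightarrow> fg_module R M \<and>
     (\<exists>n f g (X :: ('a, (nat \<Rightarrow> 'm) set) module).
        Deep R \<mm> X \<and> short_exact R (regular_module R) (power_module M n) X f g)"

definition transport_module :: "('x \<Rightarrow> 'y) \<Rightarrow> ('a, 'x, 'c) module_scheme \<Rightarrow> ('a, 'y) module" where
  "transport_module \<phi> X = (let \<psi> = the_inv_into (carrier X) \<phi> in
     \<lparr>carrier = \<phi> ` carrier X, monoid.mult = undefined, one = undefined, zero = \<phi> \<zero>\<^bsub>X\<^esub>,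
      add = (\<lambda>u v. \<phi> (\<psi> u \<oplus>\<^bsub>X\<^esub> \<psi> v)), smult = (\<lambda>a u. \<phi> (a \<odot>\<^bsub>X\<^esub> \<psi> u))\<rparr>)"

context
  fixes R :: "('a, 'k) ring_scheme" and X :: "('a, 'x, 'c) module_scheme" and \<phi> :: "'x \<Rightarrow> 'y"
  assumes X: "module R X" and inj: "inj_on \<phi> (carrier X)"
begin

interpretation module R X by (rule X)

private abbreviation (input) "Y \<equiv> transport_module \<phi> X"

lemma transport_simps:
  "carrier Y = \<phi> ` carrier X" "\<zero>\<^bsub>Y\<^esub> = \<phi> \<zero>\<^bsub>X\<^esub>"
  "u \<in> carrier X \<Longrightarrow> v \<in> carrier X \<Longrightarrow> \<phi> u \<oplus>\<^bsub>Y\<^esub> \<phi> v = \<phi> (u \<oplus>\<^bsub>X\<^esub> v)"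
  "u \<in> carrier X \<Longrightarrow> a \<odot>\<^bsub>Y\<^esub> \<phi> u = \<phi> (a \<odot>\<^bsub>X\<^esub> u)"
  by (simp_all add: transport_module_def Let_def the_inv_into_f_f[OF inj])

lemma transport_is_module: "module R Y"
proof (rule moduleI)
  show "abelian_group Y"
  proof (rule abelian_groupI)
    fix x assume "x \<in> carrier Y"
    then obtain u where u: "u \<in> carrier X" "x = \<phi> u" by (auto simp: transport_simps)
    then have "\<phi> (\<ominus>\<^bsub>X\<^esub> u) \<in> carrier Y \<and> \<phi> (\<ominus>\<^bsub>X\<^esub> u) \<oplus>\<^bsub>Y\<^esub> x = \<zero>\<^bsub>Y\<^esub>"
      by (simp add: transport_simps M.l_neg)
    then show "\<exists>y\<in>carrier Y. y \<oplus>\<^bsub>Y\<^esub> x = \<zero>\<^bsub>Y\<^esub>" by blast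
  qed (auto simp: transport_simps M.a_assoc intro!: arg_cong[where f = \<phi>] M.a_comm)
qed (auto simp: transport_simps smult_l_distr smult_r_distr smult_assoc1 R.is_cring)

lemma transport_hom: "\<phi> \<in> mod_hom R X Y"
  by (auto simp: mod_hom_def hom_def transport_simps)

lemma transport_fg:
  assumes "fg_module R X"
  shows "fg_module R Y"
proof -
  obtain A where A: "A \<subseteq> carrier X" "finite A"
      "\<And>H. submodule H R X \<Longrightarrow> A \<subseteq> H \<Longrightarrow> H = carrier X"
    using assms by (auto simp: fg_module_def)
  have "H = carrier Y" if H: "submodule H R Y" "\<phi> ` A \<subseteq> H" for H
  proof -
    note HE = module.submoduleE[OF transport_is_module H(1)]
    have z: "\<zero>\<^bsub>Y\<^esub> \<in> H"
      using H(1) subgroup.one_closed[of H "add_monoid Y"] by (simp add: submodule_def)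
    have "submodule {x \<in> carrier X. \<phi> x \<in> H} R X"
    proof (rule submoduleI)
      fix a assume a: "a \<in> {x \<in> carrier X. \<phi> x \<in> H}"
      have "\<phi> (\<ominus>\<^bsub>X\<^esub> a) = \<phi> ((\<ominus>\<^bsub>R\<^esub> \<one>\<^bsub>R\<^esub>) \<odot>\<^bsub>X\<^esub> a)"
        using a smult_l_minus[of "\<one>\<^bsub>R\<^esub>" a] by simp
      also have "\<dots> \<in> H"
        using HE(4)[of "\<ominus>\<^bsub>R\<^esub> \<one>\<^bsub>R\<^esub>" "\<phi> a"] a by (simp add: transport_simps)
      finally show "\<ominus>\<^bsub>X\<^esub> a \<in> {x \<in> carrier X. \<phi> x \<in> H}" using a by simp
    next
      fix a b assume "a \<in> {x \<in> carrier X. \<phi> x \<in> H}" "b \<in> {x \<in> carrier X. \<phi> x \<in> H}"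
      then show "a \<oplus>\<^bsub>X\<^esub> b \<in> {x \<in> carrier X. \<phi> x \<in> H}"
        using HE(5)[of "\<phi> a" "\<phi> b"] by (simp add: transport_simps)
    next
      fix a x assume "a \<in> carrier R" "x \<in> {x \<in> carrier X. \<phi> x \<in> H}"
      then show "a \<odot>\<^bsub>X\<^esub> x \<in> {x \<in> carrier X. \<phi> x \<in> H}"
        using HE(4)[of a "\<phi> x"] by (simp add: transport_simps)
    qed (use z in \<open>auto simp: transport_simps\<close>)
    moreover have "A \<subseteq> {x \<in> carrier X. \<phi> x \<in> H}" using A(1) H(2) by auto
    ultimately have "{x \<in> carrier X. \<phi> x \<in> H} = carrier X" by (rule A(3))
    then show ?thesis using HE(1) by (auto simp: transport_simps)
  qed
  moreover have "\<phi> ` A \<subseteq> carrier Y" using A(1) by (auto simp: transport_simps)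
  ultimately show ?thesis
    unfolding fg_module_def using transport_is_module A(2) by blast
qed

lemma seq_smult_closed: "set xs \<subseteq> carrier R \<Longrightarrow> seq_smult X xs \<subseteq> carrier X"
  by (induction xs) (auto simp: set_add_def set_mult_def)

lemma transport_seq_smult:
  "set xs \<subseteq> carrier R \<Longrightarrow> seq_smult Y xs = \<phi> ` seq_smult X xs"
proof (induction xs)
  case (Cons x xs)
  then have c: "seq_smult X xs \<subseteq> carrier X" "x \<in> carrier R" using seq_smult_closed by auto
  show ?case
  proof (intro equalityI subsetI)
    fix w assume "w \<in> seq_smult Y (x # xs)"
    then obtain u v where uv: "u \<in> carrier X" "v \<in> seq_smult X xs"
        "w = (x \<odot>\<^bsub>Y\<^esub> \<phi> u) \<oplus>\<^bsub>Y\<^esub> \<phi> v"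
      using Cons by (auto simp: set_add_def set_mult_def transport_simps)
    then have "w = \<phi> (x \<odot>\<^bsub>X\<^esub> u \<oplus>\<^bsub>X\<^esub> v)" using c by (auto simp: transport_simps)
    then show "w \<in> \<phi> ` seq_smult X (x # xs)" using uv by (auto simp: set_add_def set_mult_def)
  next
    fix w assume "w \<in> \<phi> ` seq_smult X (x # xs)"
    then obtain u v where uv: "u \<in> carrier X" "v \<in> seq_smult X xs"
        "w = \<phi> (x \<odot>\<^bsub>X\<^esub> u \<oplus>\<^bsub>X\<^esub> v)"
      by (auto simp: set_add_def set_mult_def)
    then have w: "w = (x \<odot>\<^bsub>Y\<^esub> \<phi> u) \<oplus>\<^bsub>Y\<^esub> \<phi> v"
      using c by (auto simp: transport_simps subset_iff)
    moreover have "\<phi> u \<in> carrier Y" "\<phi> v \<in> seq_smult Y xs"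
      using uv Cons by (auto simp: transport_simps)
    ultimately show "w \<in> seq_smult Y (x # xs)"
      unfolding seq_smult.simps set_add_def' by (metis UN_I imageI singletonI)
  qed
qed (simp add: transport_simps)

lemma transport_regular_seq:
  assumes "set xs \<subseteq> carrier R"
  shows "regular_seq Y xs \<longleftrightarrow> regular_seq X xs"
proof -
  have t: "set (take i xs) \<subseteq> carrier R" for i
    using assms set_take_subset by fast
  have mem: "\<phi> u \<in> \<phi> ` seq_smult X (take i xs) \<longleftrightarrow> u \<in> seq_smult X (take i xs)"
    if "u \<in> carrier X" for u i
    using inj_on_image_mem_iff[OF inj that seq_smult_closed[OF t]] .
  have eq: "\<phi> ` seq_smult X xs = \<phi> ` carrier X \<longleftrightarrow> seq_smult X xs = carrier X"
    using inj_on_image_eq_iff[OF inj seq_smult_closed[OF assms]] by simp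
  have x: "xs ! i \<in> carrier R" if "i < length xs" for i
    using that assms by auto
  show ?thesis
    unfolding regular_seq_def transport_seq_smult[OF t] transport_seq_smult[OF assms]
    by (simp add: transport_simps eq mem x)
qed

lemma transport_depth:
  assumes "\<mm> \<subseteq> carrier R"
  shows "depth \<mm> Y = depth \<mm> X"
proof -
  have "carrier Y = {\<zero>\<^bsub>Y\<^esub>} \<longleftrightarrow> carrier X = {\<zero>\<^bsub>X\<^esub>}"
    using inj_on_image_eq_iff[OF inj, of "carrier X" "{\<zero>\<^bsub>X\<^esub>}"] by (simp add: transport_simps)
  moreover have "{enat (length xs) |xs. set xs \<subseteq> \<mm> \<and> regular_seq Y xs} =
      {enat (length xs) |xs. set xs \<subseteq> \<mm> \<and> regular_seq X xs}"
    using transport_regular_seq assms by (meson subset_trans)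
  ultimately show ?thesis by (simp add: depth_def)
qed

lemma transport_Deep:
  assumes "\<mm> \<subseteq> carrier R" "Deep R \<mm> X"
  shows "Deep R \<mm> Y"
  using assms transport_depth transport_fg by (simp add: Deep_def)

lemma transport_exact:
  assumes "short_exact R L N X f g"
  shows "short_exact R L N Y f (\<phi> \<circ> g)"
proof -
  have g: "g \<in> mod_hom R N X" "g ` carrier N = carrier X" "f ` carrier L = a_kernel N X g"
    using assms by (auto simp: short_exact_def)
  then have gc: "g u \<in> carrier X" if "u \<in> carrier N" for u using that by auto
  have "\<phi> \<circ> g \<in> mod_hom R N Y"
    using g(1) gc by (auto simp: mod_hom_def hom_def transport_simps)
  moreover have "a_kernel N Y (\<phi> \<circ> g) = a_kernel N X g"
    using gc inj by (auto simp: a_kernel_def' transport_simps inj_on_eq_iff)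
  moreover have "(\<phi> \<circ> g) ` carrier N = carrier Y"
    unfolding image_comp[symmetric] g(2) transport_simps(1) ..
  ultimately show ?thesis
    using assms by (auto simp: short_exact_def)
qed

end

lemma short_exact_surj: "short_exact R L M N f g \<Longrightarrow> g ` carrier M = carrier N"
  by (simp add: short_exact_def)

lemma fibre_inj:
  assumes "g ` carrier N = carrier X"
  shows "inj_on (\<lambda>x. {v \<in> carrier N. g v = x}) (carrier X)"
proof (rule inj_onI)
  fix x y assume x: "x \<in> carrier X" and e: "{v \<in> carrier N. g v = x} = {v \<in> carrier N. g v = y}"
  from x obtain v where v: "v \<in> carrier N" "g v = x"
    unfolding assms[symmetric] by (elim imageE) simp
  then have "v \<in> {v \<in> carrier N. g v = y}" by (subst e[symmetric]) simp
  then show "x = y" using v by simp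
qed

lemma Omega_DeepI:
  assumes "\<mm> \<subseteq> carrier R" "fg_module R M" "Deep R \<mm> X"
    and "short_exact R M (power_module (regular_module R) n) X f g"
  shows "Omega_Deep R \<mm> M"
proof -
  let ?\<phi> = "\<lambda>x. {v \<in> carrier (power_module (regular_module R) n). g v = x}"
  have "module R X" "inj_on ?\<phi> (carrier X)"
    using assms(3) fibre_inj short_exact_surj[OF assms(4)]
    by (simp_all only: Deep_def fg_module_def)
  note transported = transport_Deep[OF this assms(1,3)] transport_exact[OF this assms(4)]
  show ?thesis unfolding Omega_Deep_def by (intro conjI exI) (rule assms(2) transported)+
qed

lemma DFI:
  assumes "\<mm> \<subseteq> carrier R" "fg_module R M" "Deep R \<mm> X"
    and "short_exact R (regular_module R) (power_module M n) X f g"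
  shows "DF R \<mm> M"
proof -
  let ?\<phi> = "\<lambda>x. {v \<in> carrier (power_module M n). g v = x}"
  have "module R X" "inj_on ?\<phi> (carrier X)"
    using assms(3) fibre_inj short_exact_surj[OF assms(4)]
    by (simp_all only: Deep_def fg_module_def)
  note transported = transport_Deep[OF this assms(1,3)] transport_exact[OF this assms(4)]
  show ?thesis unfolding DF_def by (intro conjI exI) (rule assms(2) transported)+
qed

end

theory Submission
  imports Defs
begin

text \<open>Choose a sequence \<open>x\<close> in \<open>\<mm>\<close> that is weakly regular on the deep cokernels of the given exact
  sequences and for which \<open>R/xR\<close> has a nonzero socle element \<open>s\<close>. Weak regularity on the cokernel
  makes each inclusion remain injective modulo \<open>x\<close>. If \<open>R\<close> is not a summand of \<open>M \<subseteq> R\<^sup>n\<close>, then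
  \<open>M \<subseteq> \<mm>R\<^sup>n\<close>, hence \<open>s\<close> kills \<open>M/xM\<close>. In both cases \<open>s\<close> then kills \<open>N/xN\<close>, which is a quotient or
  a submodule of \<open>M/xM\<close>, and therefore also \<open>R/xR \<subseteq> (N/xN)\<^sup>n\<close>, a contradiction.

  Quotients \<open>M/U\<close> are never formed: regularity, socles and depth are expressed relative to a
  submodule \<open>U\<close>.\<close>

section \<open>Congruence modulo a submodule\<close>

text \<open>The main work is the existence of the pair x, s. Membership in \<open>Deep\<close> only
  bounds a supremum of lengths, whereas x grows one element at a time, so any weakly regular
  sequence shorter than the depth must be known to extend. Instead of describing depth by Ext, the
  proof exchanges socles between M/(U + aM) and M/(U + bM), which shows that dividing by any regular
  element costs at most one unit of depth. The extending element has to serve R and all cokernels at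
  once, and these live over different types. Each condition is therefore phrased as avoidance of
  finitely many primes of R, a statement about R alone, and such conditions can be pooled. Weak
  regularity is the right notion because a cokernel may be zero; on R itself properness is
  automatic, as x lies in \<mm>.\<close>

definition (in module) cong_mod :: "'c set \<Rightarrow> 'c \<Rightarrow> 'c \<Rightarrow> bool" where
  "cong_mod U x y \<longleftrightarrow> x \<in> carrier M \<and> y \<in> carrier M \<and> x \<ominus>\<^bsub>M\<^esub> y \<in> U"

context module
begin

lemma submodule_zero: "submodule U R M \<Longrightarrow> \<zero>\<^bsub>M\<^esub> \<in> U"
  using subgroup.one_closed[of U "add_monoid M"] by (simp add: submodule_def)

lemma submodule_zero_set: "submodule {\<zero>\<^bsub>M\<^esub>} R M"
  by (rule submoduleI) auto

lemma submodule_diff: "submodule U R M \<Longrightarrow> x \<in> U \<Longrightarrow> y \<in> U \<Longrightarrow> x \<ominus>\<^bsub>M\<^esub> y \<in> U"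
  using submoduleE(3,5) by (simp add: M.minus_eq)

lemma minus_self: "x \<in> carrier M \<Longrightarrow> x \<ominus>\<^bsub>M\<^esub> x = \<zero>\<^bsub>M\<^esub>"
  by (simp add: M.minus_eq M.r_neg)

lemma minus_zero_right: "x \<in> carrier M \<Longrightarrow> x \<ominus>\<^bsub>M\<^esub> \<zero>\<^bsub>M\<^esub> = x"
  by (simp add: M.minus_eq)

lemma minus_swap: "x \<in> carrier M \<Longrightarrow> y \<in> carrier M \<Longrightarrow> \<ominus>\<^bsub>M\<^esub> (x \<ominus>\<^bsub>M\<^esub> y) = y \<ominus>\<^bsub>M\<^esub> x"
  by (simp add: M.minus_eq M.minus_add M.a_comm)

lemma minus_trans:
  "x \<in> carrier M \<Longrightarrow> y \<in> carrier M \<Longrightarrow> z \<in> carrier M \<Longrightarrow>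
    (x \<ominus>\<^bsub>M\<^esub> y) \<oplus>\<^bsub>M\<^esub> (y \<ominus>\<^bsub>M\<^esub> z) = x \<ominus>\<^bsub>M\<^esub> z"
  by (simp add: M.minus_eq M.a_assoc M.r_neg1)

lemma smult_r_diff:
  "a \<in> carrier R \<Longrightarrow> x \<in> carrier M \<Longrightarrow> y \<in> carrier M \<Longrightarrow>
    a \<odot>\<^bsub>M\<^esub> (x \<ominus>\<^bsub>M\<^esub> y) = a \<odot>\<^bsub>M\<^esub> x \<ominus>\<^bsub>M\<^esub> a \<odot>\<^bsub>M\<^esub> y"
  by (simp add: M.minus_eq smult_r_distr smult_r_minus)

lemma smult_left_commute:
  "a \<in> carrier R \<Longrightarrow> b \<in> carrier R \<Longrightarrow> x \<in> carrier M \<Longrightarrow>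
    a \<odot>\<^bsub>M\<^esub> (b \<odot>\<^bsub>M\<^esub> x) = b \<odot>\<^bsub>M\<^esub> (a \<odot>\<^bsub>M\<^esub> x)"
  by (metis R.m_comm smult_assoc1)

lemma diff_add_diff:
  "\<lbrakk>x \<in> carrier M; y \<in> carrier M; z \<in> carrier M; w \<in> carrier M\<rbrakk> \<Longrightarrow>
    (x \<oplus>\<^bsub>M\<^esub> z) \<ominus>\<^bsub>M\<^esub> (y \<oplus>\<^bsub>M\<^esub> w) = (x \<ominus>\<^bsub>M\<^esub> y) \<oplus>\<^bsub>M\<^esub> (z \<ominus>\<^bsub>M\<^esub> w)"
  by (simp add: M.minus_eq M.minus_add M.a_ac)

lemma cong_refl: "submodule U R M \<Longrightarrow> x \<in> carrier M \<Longrightarrow> cong_mod U x x"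
  by (simp add: cong_mod_def minus_self submodule_zero)

lemma cong_sym: "submodule U R M \<Longrightarrow> cong_mod U x y \<Longrightarrow> cong_mod U y x"
  using submoduleE(3)[of U "x \<ominus>\<^bsub>M\<^esub> y"] by (simp add: cong_mod_def minus_swap)

lemma cong_trans:
  "submodule U R M \<Longrightarrow> cong_mod U x y \<Longrightarrow> cong_mod U y z \<Longrightarrow> cong_mod U x z"
  using submoduleE(5)[of U "x \<ominus>\<^bsub>M\<^esub> y" "y \<ominus>\<^bsub>M\<^esub> z"] by (simp add: cong_mod_def minus_trans)

lemma cong_smult:
  "submodule U R M \<Longrightarrow> a \<in> carrier R \<Longrightarrow> cong_mod U x y \<Longrightarrow> cong_mod U (a \<odot>\<^bsub>M\<^esub> x) (a \<odot>\<^bsub>M\<^esub> y)"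
  by (auto simp: cong_mod_def submoduleE(4) simp flip: smult_r_diff)

lemma cong_add:
  "submodule U R M \<Longrightarrow> cong_mod U x y \<Longrightarrow> cong_mod U z w \<Longrightarrow> cong_mod U (x \<oplus>\<^bsub>M\<^esub> z) (y \<oplus>\<^bsub>M\<^esub> w)"
  by (simp add: cong_mod_def diff_add_diff submoduleE(5))

lemma cong_zero_iff: "x \<in> carrier M \<Longrightarrow> cong_mod U x \<zero>\<^bsub>M\<^esub> \<longleftrightarrow> x \<in> U"
  by (simp add: cong_mod_def minus_zero_right)

lemma cong_mem_iff:
  assumes "submodule U R M" "cong_mod U x y"
  shows "x \<in> U \<longleftrightarrow> y \<in> U"
  using cong_trans[OF assms(1)] cong_sym[OF assms] assms(2) cong_zero_iff[of x] cong_zero_iff[of y]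
  unfolding cong_mod_def by blast

lemma cong_carrier: "cong_mod U x y \<Longrightarrow> x \<in> carrier M \<and> y \<in> carrier M"
  by (simp add: cong_mod_def)

text \<open>A sum V + U is the preimage of the image of V in M/U. In this form the closure
  properties of sums follow from those of V and of congruence.\<close>

lemma mem_set_add_iff:
  assumes "submodule U R M" "submodule V R M"
  shows "x \<in> V <+>\<^bsub>M\<^esub> U \<longleftrightarrow> (\<exists>v\<in>V. cong_mod U x v)"
proof
  assume "x \<in> V <+>\<^bsub>M\<^esub> U"
  then obtain v u where uv: "v \<in> V" "u \<in> U" "x = v \<oplus>\<^bsub>M\<^esub> u"
    by (auto simp: set_add_def set_mult_def)
  then have c: "v \<in> carrier M" "u \<in> carrier M" using assms submoduleE(1) by auto
  then have "cong_mod U (v \<oplus>\<^bsub>M\<^esub> u) (v \<oplus>\<^bsub>M\<^esub> \<zero>\<^bsub>M\<^esub>)"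
    using uv by (intro cong_add cong_refl assms) (simp_all add: cong_zero_iff)
  then show "\<exists>v\<in>V. cong_mod U x v" using uv c by auto
next
  assume "\<exists>v\<in>V. cong_mod U x v"
  then obtain v where v: "v \<in> V" "x \<in> carrier M" "v \<in> carrier M" "x \<ominus>\<^bsub>M\<^esub> v \<in> U"
    by (auto simp: cong_mod_def)
  then have "x = v \<oplus>\<^bsub>M\<^esub> (x \<ominus>\<^bsub>M\<^esub> v)"
    using M.a_lcomm[of v x "\<ominus>\<^bsub>M\<^esub> v"] by (simp add: M.minus_eq M.r_neg)
  then show "x \<in> V <+>\<^bsub>M\<^esub> U" using v
    unfolding set_add_def' by blast
qed

lemma submodule_set_add:
  assumes U: "submodule U R M" and V: "submodule V R M"
  shows "submodule (V <+>\<^bsub>M\<^esub> U) R M"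
proof (rule submoduleI)
  note mem = mem_set_add_iff[OF U V]
  show "V <+>\<^bsub>M\<^esub> U \<subseteq> carrier M"
    using cong_carrier by (auto simp: mem)
  show "\<zero>\<^bsub>M\<^esub> \<in> V <+>\<^bsub>M\<^esub> U"
    unfolding mem using submodule_zero[OF V] cong_refl[OF U M.zero_closed] by blast
  show smult: "a \<odot>\<^bsub>M\<^esub> x \<in> V <+>\<^bsub>M\<^esub> U" if "a \<in> carrier R" "x \<in> V <+>\<^bsub>M\<^esub> U" for a x
    using that unfolding mem using cong_smult[OF U] submoduleE(4)[OF V] by blast
  show "x \<oplus>\<^bsub>M\<^esub> y \<in> V <+>\<^bsub>M\<^esub> U" if "x \<in> V <+>\<^bsub>M\<^esub> U" "y \<in> V <+>\<^bsub>M\<^esub> U" for x y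
    using that unfolding mem using cong_add[OF U] submoduleE(5)[OF V] by blast
  show "\<ominus>\<^bsub>M\<^esub> x \<in> V <+>\<^bsub>M\<^esub> U" if x: "x \<in> V <+>\<^bsub>M\<^esub> U" for x
  proof -
    have "x \<in> carrier M" using x mem cong_carrier by blast
    then show ?thesis
      using smult[OF _ x, of "\<ominus>\<^bsub>R\<^esub> \<one>\<^bsub>R\<^esub>"] smult_l_minus[of "\<one>\<^bsub>R\<^esub>" x] by simp
  qed
qed

lemma submodule_smult_image:
  assumes a: "a \<in> carrier R"
  shows "submodule ((\<lambda>u. a \<odot>\<^bsub>M\<^esub> u) ` carrier M) R M"
proof (rule submoduleI)
  show "\<zero>\<^bsub>M\<^esub> \<in> (\<lambda>u. a \<odot>\<^bsub>M\<^esub> u) ` carrier M"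
    using a by (intro image_eqI[of _ _ "\<zero>\<^bsub>M\<^esub>"]) simp_all
next
  fix x assume "x \<in> (\<lambda>u. a \<odot>\<^bsub>M\<^esub> u) ` carrier M"
  then show "\<ominus>\<^bsub>M\<^esub> x \<in> (\<lambda>u. a \<odot>\<^bsub>M\<^esub> u) ` carrier M"
    using a smult_r_minus[of a, symmetric] by auto
next
  fix x y assume "x \<in> (\<lambda>u. a \<odot>\<^bsub>M\<^esub> u) ` carrier M" "y \<in> (\<lambda>u. a \<odot>\<^bsub>M\<^esub> u) ` carrier M"
  then show "x \<oplus>\<^bsub>M\<^esub> y \<in> (\<lambda>u. a \<odot>\<^bsub>M\<^esub> u) ` carrier M"
    using a smult_r_distr[of a, symmetric] by auto
next
  fix b x assume "b \<in> carrier R" "x \<in> (\<lambda>u. a \<odot>\<^bsub>M\<^esub> u) ` carrier M"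
  then show "b \<odot>\<^bsub>M\<^esub> x \<in> (\<lambda>u. a \<odot>\<^bsub>M\<^esub> u) ` carrier M"
    using a smult_left_commute[of b a] by auto
qed (use a in auto)

lemma submodule_cyclic:
  assumes g: "g \<in> carrier M"
  shows "submodule ((\<lambda>c. c \<odot>\<^bsub>M\<^esub> g) ` carrier R) R M"
proof (rule submoduleI)
  show "\<zero>\<^bsub>M\<^esub> \<in> (\<lambda>c. c \<odot>\<^bsub>M\<^esub> g) ` carrier R"
    using g by (intro image_eqI[of _ _ "\<zero>\<^bsub>R\<^esub>"]) simp_all
next
  fix x assume "x \<in> (\<lambda>c. c \<odot>\<^bsub>M\<^esub> g) ` carrier R"
  then show "\<ominus>\<^bsub>M\<^esub> x \<in> (\<lambda>c. c \<odot>\<^bsub>M\<^esub> g) ` carrier R"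
    using g smult_l_minus[of _ g, symmetric] by auto
next
  fix x y assume "x \<in> (\<lambda>c. c \<odot>\<^bsub>M\<^esub> g) ` carrier R" "y \<in> (\<lambda>c. c \<odot>\<^bsub>M\<^esub> g) ` carrier R"
  then show "x \<oplus>\<^bsub>M\<^esub> y \<in> (\<lambda>c. c \<odot>\<^bsub>M\<^esub> g) ` carrier R"
    using g smult_l_distr[of _ _ g, symmetric] by auto
next
  fix b x assume "b \<in> carrier R" "x \<in> (\<lambda>c. c \<odot>\<^bsub>M\<^esub> g) ` carrier R"
  then show "b \<odot>\<^bsub>M\<^esub> x \<in> (\<lambda>c. c \<odot>\<^bsub>M\<^esub> g) ` carrier R"
    using g smult_assoc1[of b _ g, symmetric] by auto
qed (use g in auto)

lemma mem_add_cyclic_iff: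
  "submodule U R M \<Longrightarrow> g \<in> carrier M \<Longrightarrow>
    x \<in> (\<lambda>c. c \<odot>\<^bsub>M\<^esub> g) ` carrier R <+>\<^bsub>M\<^esub> U \<longleftrightarrow>
      (\<exists>c \<in> carrier R. cong_mod U x (c \<odot>\<^bsub>M\<^esub> g))"
  using mem_set_add_iff[OF _ submodule_cyclic] by auto

lemma subset_add_cyclic:
  assumes U: "submodule U R M" and g: "g \<in> carrier M"
  shows "insert g U \<subseteq> (\<lambda>c. c \<odot>\<^bsub>M\<^esub> g) ` carrier R <+>\<^bsub>M\<^esub> U"
proof -
  have "cong_mod U g (\<one>\<^bsub>R\<^esub> \<odot>\<^bsub>M\<^esub> g)" using cong_refl[OF U g] g by simp
  moreover have "cong_mod U x (\<zero>\<^bsub>R\<^esub> \<odot>\<^bsub>M\<^esub> g)" if "x \<in> U" for x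
    using that g submoduleE(1)[OF U] cong_zero_iff[of x U] by auto
  ultimately show ?thesis using mem_add_cyclic_iff[OF U g] by blast
qed

text \<open>A submodule \<open>U\<close> stands for the module \<open>M/U\<close>, so
  \<open>deep_mod I n U\<close> says that \<open>I\<close> contains a weakly regular sequence of length \<open>n\<close> on \<open>M/U\<close>.\<close>

definition add_multiples :: "'a \<Rightarrow> 'c set \<Rightarrow> 'c set" where
  "add_multiples a U = ((\<lambda>u. a \<odot>\<^bsub>M\<^esub> u) ` carrier M) <+>\<^bsub>M\<^esub> U"

definition regular_mod :: "'c set \<Rightarrow> 'a \<Rightarrow> bool" where
  "regular_mod U a \<longleftrightarrow> (\<forall>u \<in> carrier M. a \<odot>\<^bsub>M\<^esub> u \<in> U \<longrightarrow> u \<in> U)"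

text \<open>For an ideal I this is Hom(R/I, M/U) = 0. It can be exchanged between quotients, and for
  finitely generated M over a Noetherian ring it forces I to contain a nonzerodivisor on
  M/U.\<close>

definition trivial_socle :: "'a set \<Rightarrow> 'c set \<Rightarrow> bool" where
  "trivial_socle I U \<longleftrightarrow> (\<forall>u \<in> carrier M. (\<forall>c \<in> I. c \<odot>\<^bsub>M\<^esub> u \<in> U) \<longrightarrow> u \<in> U)"

primrec deep_mod :: "'a set \<Rightarrow> nat \<Rightarrow> 'c set \<Rightarrow> bool" where
  "deep_mod I 0 U \<longleftrightarrow> True"
| "deep_mod I (Suc n) U \<longleftrightarrow> (\<exists>a \<in> I. regular_mod U a \<and> deep_mod I n (add_multiples a U))"

lemma submodule_add_multiples:
  "a \<in> carrier R \<Longrightarrow> submodule U R M \<Longrightarrow> submodule (add_multiples a U) R M"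
  unfolding add_multiples_def by (intro submodule_set_add submodule_smult_image)

lemma mem_add_multiples_iff:
  "a \<in> carrier R \<Longrightarrow> submodule U R M \<Longrightarrow>
    x \<in> add_multiples a U \<longleftrightarrow> (\<exists>w \<in> carrier M. cong_mod U x (a \<odot>\<^bsub>M\<^esub> w))"
  unfolding add_multiples_def by (subst mem_set_add_iff) (auto intro: submodule_smult_image)

lemma add_multiples_commute:
  assumes "a \<in> carrier R" "b \<in> carrier R" "submodule U R M"
  shows "add_multiples a (add_multiples b U) = add_multiples b (add_multiples a U)"
proof -
  let ?m = "\<lambda>a. (\<lambda>u. a \<odot>\<^bsub>M\<^esub> u) ` carrier M"
  have c: "?m a \<subseteq> carrier M" "?m b \<subseteq> carrier M" "U \<subseteq> carrier M"
    using assms submoduleE(1) by auto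
  then have comm: "?m a <+>\<^bsub>M\<^esub> ?m b = ?m b <+>\<^bsub>M\<^esub> ?m a"
    using M.add.commut_normal[OF submodule.axioms(1) M.add.subgroup_imp_normal[OF submodule.axioms(1)]]
      submodule_smult_image assms(1,2) unfolding set_add_def by blast
  have "?m a <+>\<^bsub>M\<^esub> (?m b <+>\<^bsub>M\<^esub> U) = (?m a <+>\<^bsub>M\<^esub> ?m b) <+>\<^bsub>M\<^esub> U"
    unfolding set_add_def using M.add.set_mult_assoc[of "?m a" "?m b" U] c by simp
  also have "\<dots> = (?m b <+>\<^bsub>M\<^esub> ?m a) <+>\<^bsub>M\<^esub> U" by (simp only: comm)
  also have "\<dots> = ?m b <+>\<^bsub>M\<^esub> (?m a <+>\<^bsub>M\<^esub> U)"
    unfolding set_add_def using M.add.set_mult_assoc[of "?m b" "?m a" U] c by simp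
  finally show ?thesis by (simp only: add_multiples_def)
qed

lemma regular_mod_cong:
  assumes "regular_mod U a" "a \<in> carrier R" "x \<in> carrier M" "y \<in> carrier M"
    "cong_mod U (a \<odot>\<^bsub>M\<^esub> x) (a \<odot>\<^bsub>M\<^esub> y)"
  shows "cong_mod U x y"
  using assms by (auto simp: cong_mod_def regular_mod_def smult_r_diff)

text \<open>If bu = cw modulo U, regularity of c modulo bM turns w into bz, and b cancels from bu =
  bcz. This is the half of permuting a regular sequence that holds without Nakayama; regularity of c
  on M/U is not claimed and has to be arranged by the choice of c.\<close>

lemma regular_mod_swap:
  assumes U: "submodule U R M" and b: "b \<in> carrier R" and c: "c \<in> carrier R"
    and rb: "regular_mod U b" and rc: "regular_mod (add_multiples b U) c"
  shows "regular_mod (add_multiples c U) b"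
  unfolding regular_mod_def
proof (intro ballI impI)
  fix u assume u: "u \<in> carrier M" "b \<odot>\<^bsub>M\<^esub> u \<in> add_multiples c U"
  note mem = mem_add_multiples_iff[OF _ U]
  obtain w where w: "w \<in> carrier M" "cong_mod U (b \<odot>\<^bsub>M\<^esub> u) (c \<odot>\<^bsub>M\<^esub> w)"
    using u mem[OF c] by auto
  have "c \<odot>\<^bsub>M\<^esub> w \<in> add_multiples b U"
    using cong_sym[OF U w(2)] u(1) mem[OF b] by auto
  then have "w \<in> add_multiples b U"
    using rc w(1) by (auto simp: regular_mod_def)
  then obtain z where z: "z \<in> carrier M" "cong_mod U w (b \<odot>\<^bsub>M\<^esub> z)"
    using mem[OF b] by auto
  have "cong_mod U (b \<odot>\<^bsub>M\<^esub> u) (b \<odot>\<^bsub>M\<^esub> (c \<odot>\<^bsub>M\<^esub> z))"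
    using cong_trans[OF U w(2) cong_smult[OF U c z(2)]] smult_left_commute[OF c b z(1)] by simp
  then have "cong_mod U u (c \<odot>\<^bsub>M\<^esub> z)"
    using regular_mod_cong[OF rb b u(1)] c z(1) by simp
  then show "u \<in> add_multiples c U"
    using z(1) mem[OF c] by auto
qed

text \<open>The socles of \<open>M / (U + bM)\<close> and \<open>M / (U + aM)\<close> are isomorphic:
  \<open>u\<close> corresponds to the class \<open>w\<close> with \<open>bu = aw\<close> modulo \<open>U\<close>.\<close>

lemma trivial_socle_exchange:
  assumes U: "submodule U R M" and I: "I \<subseteq> carrier R" and a: "a \<in> I" and b: "b \<in> I"
    and ra: "regular_mod U a" and rb: "regular_mod U b"
    and soc: "trivial_socle I (add_multiples b U)"
  shows "trivial_socle I (add_multiples a U)"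
  unfolding trivial_socle_def
proof (intro ballI impI)
  fix u assume u: "u \<in> carrier M" "\<forall>c\<in>I. c \<odot>\<^bsub>M\<^esub> u \<in> add_multiples a U"
  note mem = mem_add_multiples_iff[OF _ U]
  have aR: "a \<in> carrier R" and bR: "b \<in> carrier R" using a b I by auto
  obtain w where w: "w \<in> carrier M" "cong_mod U (b \<odot>\<^bsub>M\<^esub> u) (a \<odot>\<^bsub>M\<^esub> w)"
    using u(2) b mem[OF aR] by blast
  \<comment> \<open>Modulo U, a(cw) = c(bu) = b(cu) = a(bw'), and a cancels. Once w = bz is known,
    cancelling b in bu = aw = b(az) leads back to u.\<close>
  have "c \<odot>\<^bsub>M\<^esub> w \<in> add_multiples b U" if c: "c \<in> I" for c
  proof -
    have cR: "c \<in> carrier R" using c I by auto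
    obtain w' where w': "w' \<in> carrier M" "cong_mod U (c \<odot>\<^bsub>M\<^esub> u) (a \<odot>\<^bsub>M\<^esub> w')"
      using u(2) c mem[OF aR] by blast
    have "cong_mod U (a \<odot>\<^bsub>M\<^esub> (c \<odot>\<^bsub>M\<^esub> w)) (b \<odot>\<^bsub>M\<^esub> (c \<odot>\<^bsub>M\<^esub> u))"
      using cong_smult[OF U cR cong_sym[OF U w(2)]] smult_left_commute[OF cR] aR bR u(1) w(1) by simp
    note * = cong_trans[OF U this]
    have "cong_mod U (a \<odot>\<^bsub>M\<^esub> (c \<odot>\<^bsub>M\<^esub> w)) (a \<odot>\<^bsub>M\<^esub> (b \<odot>\<^bsub>M\<^esub> w'))"
      using *[OF cong_smult[OF U bR w'(2)]] smult_left_commute[OF bR aR w'(1)] by simp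
    then have "cong_mod U (c \<odot>\<^bsub>M\<^esub> w) (b \<odot>\<^bsub>M\<^esub> w')"
      using regular_mod_cong[OF ra aR] cR bR w(1) w'(1) by simp
    then show ?thesis using w'(1) mem[OF bR] by blast
  qed
  then have "w \<in> add_multiples b U"
    using soc w(1) by (auto simp: trivial_socle_def)
  then obtain z where z: "z \<in> carrier M" "cong_mod U w (b \<odot>\<^bsub>M\<^esub> z)"
    using mem[OF bR] by blast
  have "cong_mod U (b \<odot>\<^bsub>M\<^esub> u) (b \<odot>\<^bsub>M\<^esub> (a \<odot>\<^bsub>M\<^esub> z))"
    using cong_trans[OF U w(2) cong_smult[OF U aR z(2)]] smult_left_commute[OF aR bR z(1)] by simp
  then have "cong_mod U u (a \<odot>\<^bsub>M\<^esub> z)"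
    using regular_mod_cong[OF rb bR u(1)] aR z(1) by simp
  then show "u \<in> add_multiples a U"
    using z(1) mem[OF aR] by blast
qed

lemma trivial_socle_if_regular:
  "a \<in> I \<Longrightarrow> regular_mod U a \<Longrightarrow> trivial_socle I U"
  by (auto simp: trivial_socle_def regular_mod_def)

lemma trivial_socle_if_deep: "deep_mod I (Suc n) U \<Longrightarrow> trivial_socle I U"
  using trivial_socle_if_regular by auto

end

section \<open>Noetherian rings and prime avoidance\<close>

text \<open>Zorn's lemma applies because in a Noetherian ring a nonempty chain of ideals contains
  its own union.\<close>

lemma (in noetherian_ring) maximal_in_ideal_set:
  assumes "S \<noteq> {}" "\<And>I. I \<in> S \<Longrightarrow> ideal I R"
  shows "\<exists>I\<in>S. \<forall>J\<in>S. I \<subseteq> J \<longrightarrow> J = I"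
proof (rule subset_Zorn_nonempty[OF assms(1)])
  fix C assume C: "C \<noteq> {}" "subset.chain S C"
  then have "subset.chain {I. ideal I R} C"
    using assms(2) by (auto simp: pred_on.chain_def)
  then have "\<Union>C \<in> C" using ideal_chain_is_trivial C(1) by blast
  then show "\<Union>C \<in> S" using C(2) by (auto simp: pred_on.chain_def)
qed

text \<open>The ascending chain condition as well-foundedness, larger ideals counting as smaller
  elements; in this form it enters a lexicographic product with the chain condition on
  submodules.\<close>

lemma (in noetherian_ring) wf_ideals:
  "wf {(J, I). ideal I R \<and> ideal J R \<and> I \<subset> J}"
proof (rule wfI_min)
  fix x Q assume x: "(x :: 'a set) \<in> Q"
  show "\<exists>z\<in>Q. \<forall>y. (y, z) \<in> {(J, I). ideal I R \<and> ideal J R \<and> I \<subset> J} \<longrightarrow> y \<notin> Q"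
  \<comment> \<open>Q may contain sets that are not ideals; such a set has no predecessor and is
    minimal at once.\<close>
  proof (cases "ideal x R")
    case True
    have "\<exists>I\<in>{I \<in> Q. ideal I R}. \<forall>J\<in>{I \<in> Q. ideal I R}. I \<subseteq> J \<longrightarrow> J = I"
      using x True by (intro maximal_in_ideal_set) auto
    then obtain I where "I \<in> Q" "ideal I R" "\<forall>J\<in>Q. ideal J R \<longrightarrow> I \<subseteq> J \<longrightarrow> J = I"
      by auto
    then show ?thesis by (intro bexI[of _ I]) auto
  qed (use x in auto)
qed

section \<open>Proper ideals and units of a local ring\<close>

context noetherian_local_ring
begin

lemma max_ideal_subset: "\<mm> \<subseteq> carrier R"
  using max_ideal additive_subgroup.a_subset ideal_def maximalideal_def by blast

lemma ideal_subset_max_ideal: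
  assumes J: "ideal J R" "\<one> \<notin> J"
  shows "J \<subseteq> \<mm>"
proof -
  obtain I where I: "ideal I R" "J \<subseteq> I" "\<one> \<notin> I"
      "\<forall>K. ideal K R \<and> J \<subseteq> K \<and> \<one> \<notin> K \<longrightarrow> I \<subseteq> K \<longrightarrow> K = I"
  proof -
    have "\<exists>I\<in>{I. ideal I R \<and> J \<subseteq> I \<and> \<one> \<notin> I}. \<forall>K\<in>{I. ideal I R \<and> J \<subseteq> I \<and> \<one> \<notin> I}. I \<subseteq> K \<longrightarrow> K = I"
      using J by (intro maximal_in_ideal_set) auto
    then show thesis using that by auto
  qed
  have "maximalideal I R"
  proof (rule maximalidealI)
    show "K = I \<or> K = carrier R" if "ideal K R" "I \<subseteq> K" "K \<subseteq> carrier R" for K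
    proof (cases "\<one> \<in> K")
      case True
      then show ?thesis using ideal.one_imp_carrier[OF that(1)] by simp
    next
      case False
      then show ?thesis using I(2,4) that(1,2) by (meson subset_trans)
    qed
  qed (use I in auto)
  then show ?thesis using max_ideal_unique I(2) by auto
qed

lemma one_notin_max_ideal: "\<one> \<notin> \<mm>"
  using maximalideal.I_notcarr[OF max_ideal] ideal.one_imp_carrier[of \<mm> R] max_ideal
  by (auto simp: maximalideal_def)

lemma left_inverse_if_notin_max_ideal:
  assumes a: "a \<in> carrier R" "a \<notin> \<mm>"
  obtains b where "b \<in> carrier R" "b \<otimes> a = \<one>"
proof -
  have "\<one> \<in> PIdl a"
    using ideal_subset_max_ideal[OF cgenideal_ideal[OF a(1)]] cgenideal_self[OF a(1)] a(2) by blast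
  then show thesis using that by (auto simp: cgenideal_def)
qed

end

text \<open>Start with an element of I outside P and multiply in one element of each Q outside P;
  primality of P keeps the product out of P.\<close>

lemma (in cring) prime_avoidance_product:
  assumes "finite S" "primeideal P R" "ideal I R" "\<not> I \<subseteq> P"
    and "\<And>Q. Q \<in> S \<Longrightarrow> ideal Q R \<and> \<not> Q \<subseteq> P"
  shows "\<exists>d \<in> I. d \<notin> P \<and> (\<forall>Q\<in>S. d \<in> Q)"
  using assms(1,5)
proof (induction S)
  case empty
  then show ?case using assms(4) by auto
next
  case (insert Q S)
  then obtain d where d: "d \<in> I" "d \<notin> P" "\<forall>Q\<in>S. d \<in> Q" by auto
  obtain q where q: "q \<in> Q" "q \<notin> P" using insert.prems[of Q] by auto
  have c: "d \<in> carrier R" "q \<in> carrier R"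
    using ideal.Icarr[OF assms(3) d(1)] ideal.Icarr[OF _ q(1), of R] insert.prems[of Q] by simp_all
  have "d \<otimes> q \<in> I" by (rule ideal.I_r_closed[OF assms(3) d(1) c(2)])
  moreover have "d \<otimes> q \<in> Q"
    using ideal.I_l_closed[of Q R q d] insert.prems[of Q] q c by simp
  moreover have "\<forall>Q\<in>S. d \<otimes> q \<in> Q"
    using ideal.I_r_closed[of _ R d q] insert.prems d c by simp
  moreover have "d \<otimes> q \<notin> P"
    using primeideal.I_prime[OF assms(2) c] d q by auto
  ultimately show ?case by blast
qed

text \<open>Induction on the number of primes. Pick P in S and let c avoid the primes of S not
  inside P. If c lies in P, it is corrected by some d in I, outside P, that lies in all those
  primes: c + d agrees with c modulo them and with d modulo P.\<close>

lemma (in cring) prime_avoidance: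
  assumes "finite S" "ideal I R"
    and "\<And>P. P \<in> S \<Longrightarrow> primeideal P R \<and> \<not> I \<subseteq> P"
  shows "\<exists>c \<in> I. \<forall>P\<in>S. c \<notin> P"
  using assms(1,3)
proof (induction "card S" arbitrary: S rule: less_induct)
  case less
  interpret I: ideal I R by fact
  show ?case
  proof (cases "S = {}")
    case True
    then show ?thesis using I.zero_closed by blast
  next
    case False
    then obtain P where P: "P \<in> S" by auto
    have pP: "primeideal P R" "\<not> I \<subseteq> P" using less.prems P by auto
    interpret P: primeideal P R by fact
    \<comment> \<open>Primes inside P are discarded along with P, since avoiding P avoids them; thus
      S may contain comparable primes.\<close>
    define S' where "S' = {Q \<in> S. \<not> Q \<subseteq> P}"
    have S': "S' \<subseteq> S - {P}" by (auto simp: S'_def)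
    then have "card S' < card S"
      using P less.prems(1) by (meson card_Diff1_less card_mono finite_Diff le_less_trans)
    moreover have "finite S'" using S' less.prems(1) finite_subset by auto
    ultimately obtain c where c: "c \<in> I" "\<forall>Q\<in>S'. c \<notin> Q"
      using less.hyps[of S'] less.prems(2) S' by blast
    show ?thesis
    proof (cases "c \<in> P")
      case False
      then have "\<forall>Q\<in>S. c \<notin> Q" using c(2) by (auto simp: S'_def)
      then show ?thesis using c(1) by blast
    next
      case True
      obtain d where d: "d \<in> I" "d \<notin> P" "\<forall>Q\<in>S'. d \<in> Q"
        using prime_avoidance_product[OF \<open>finite S'\<close> pP(1) assms(2) pP(2)] less.prems(2)
        by (auto simp: S'_def primeideal_def)
      have car: "c \<in> carrier R" "d \<in> carrier R" using c d I.Icarr by auto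
      have sub: "y \<in> Q" if "ideal Q R" "x \<in> Q" "y \<in> carrier R" "x \<oplus> y \<in> Q" for Q x y
      proof -
        interpret Q: ideal Q R by fact
        have "\<ominus> x \<oplus> (x \<oplus> y) \<in> Q" using that by blast
        then show ?thesis using that Q.Icarr by (simp add: r_neg1)
      qed
      have "c \<oplus> d \<notin> Q" if Q: "Q \<in> S" for Q
      proof (cases "Q \<subseteq> P")
        case True
        then show ?thesis using sub[OF P.is_ideal \<open>c \<in> P\<close> car(2)] d(2) by auto
      next
        case False
        then have "Q \<in> S'" using Q by (simp add: S'_def)
        then have "d \<in> Q" "c \<notin> Q" using c(2) d(3) by auto
        moreover have "ideal Q R" using less.prems(2)[OF Q] by (simp add: primeideal_def)
        ultimately have "d \<oplus> c \<notin> Q" using sub car(1) by blast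
        then show ?thesis by (simp only: a_comm[OF car] not_False_eq_True)
      qed
      then show ?thesis using c(1) d(1) by blast
    qed
  qed
qed

text \<open>By prime avoidance, generic properties concerning modules over different types can be met
  simultaneously by an element of \<open>I\<close>.\<close>

definition (in cring) generic :: "'a set \<Rightarrow> ('a \<Rightarrow> bool) \<Rightarrow> bool" where
  "generic I Q \<longleftrightarrow> (\<exists>S. finite S \<and> (\<forall>P\<in>S. primeideal P R \<and> \<not> I \<subseteq> P) \<and>
     (\<forall>a\<in>carrier R. (\<forall>P\<in>S. a \<notin> P) \<longrightarrow> Q a))"

lemma (in cring) generic_conj:
  assumes "generic I Q" "generic I Q'"
  shows "generic I (\<lambda>a. Q a \<and> Q' a)"
proof -
  obtain S where S: "finite S" "\<forall>P\<in>S. primeideal P R \<and> \<not> I \<subseteq> P"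
    "\<forall>a\<in>carrier R. (\<forall>P\<in>S. a \<notin> P) \<longrightarrow> Q a" using assms(1) by (auto simp: generic_def)
  obtain S' where S': "finite S'" "\<forall>P\<in>S'. primeideal P R \<and> \<not> I \<subseteq> P"
    "\<forall>a\<in>carrier R. (\<forall>P\<in>S'. a \<notin> P) \<longrightarrow> Q' a" using assms(2) by (auto simp: generic_def)
  show ?thesis
    unfolding generic_def by (intro exI[of _ "S \<union> S'"]) (use S S' in auto)
qed

lemma (in cring) generic_ex:
  assumes "generic I Q" "ideal I R"
  shows "\<exists>a\<in>I. Q a"
proof -
  obtain S where S: "finite S" "\<forall>P\<in>S. primeideal P R \<and> \<not> I \<subseteq> P"
    "\<forall>a\<in>carrier R. (\<forall>P\<in>S. a \<notin> P) \<longrightarrow> Q a" using assms(1) by (auto simp: generic_def)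
  then obtain a where a: "a \<in> I" "\<forall>P\<in>S. a \<notin> P"
    using prime_avoidance[OF S(1) assms(2)] by auto
  then show ?thesis using S(3) ideal.Icarr[OF assms(2)] by auto
qed

section \<open>Ascending chains and associated primes\<close>

text \<open>The ascending chain condition for submodules of K. The bound K is a parameter because
  the condition is established by adding generators one at a time.\<close>

definition (in module) acc_below :: "'c set \<Rightarrow> bool" where
  "acc_below K \<longleftrightarrow> wf {(H', H). submodule H R M \<and> submodule H' R M \<and> H \<subset> H' \<and> H' \<subseteq> K}"

context module
begin

text \<open>The colon ideal (U : u), that is, the annihilator of the class of u in M/U.\<close>

definition annihilator :: "'c set \<Rightarrow> 'c \<Rightarrow> 'a set" where
  "annihilator U u = {c \<in> carrier R. c \<odot>\<^bsub>M\<^esub> u \<in> U}"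

text \<open>The condition on c says that cg lies in H + K, so this is the colon ideal (H + K : g).
  Taking H zero gives annihilators; for H inside K + Rg it measures the image of H in the cyclic
  module (K + Rg)/K.\<close>

lemma ideal_of_submodule:
  assumes H: "submodule H R M" and K: "submodule K R M" and g: "g \<in> carrier M"
  shows "ideal {c \<in> carrier R. \<exists>h\<in>H. cong_mod K h (c \<odot>\<^bsub>M\<^esub> g)} R" (is "ideal ?I R")
proof (rule idealI)
  have smult: "x \<otimes>\<^bsub>R\<^esub> a \<in> ?I" if a: "a \<in> ?I" and x: "x \<in> carrier R" for a x
  proof -
    obtain h where h: "h \<in> H" "cong_mod K h (a \<odot>\<^bsub>M\<^esub> g)" "a \<in> carrier R" using a by auto
    then have "cong_mod K (x \<odot>\<^bsub>M\<^esub> h) ((x \<otimes>\<^bsub>R\<^esub> a) \<odot>\<^bsub>M\<^esub> g)"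
      using cong_smult[OF K x h(2)] x g by (simp add: smult_assoc1)
    then show ?thesis using submoduleE(4)[OF H x h(1)] h x by auto
  qed
  then show "x \<otimes>\<^bsub>R\<^esub> a \<in> ?I" if "a \<in> ?I" "x \<in> carrier R" for a x
    using that by blast
  show "a \<otimes>\<^bsub>R\<^esub> x \<in> ?I" if "a \<in> ?I" "x \<in> carrier R" for a x
    using smult[OF that] that R.m_comm[of a x] by simp
  show "subgroup ?I (add_monoid R)"
  proof (rule R.add.subgroupI)
    have "\<zero>\<^bsub>R\<^esub> \<in> ?I"
      using submodule_zero[OF H] cong_refl[OF K M.zero_closed] g by auto
    then show "?I \<noteq> {}" by blast
    show "\<ominus>\<^bsub>R\<^esub> a \<in> ?I" if "a \<in> ?I" for a
      using smult[OF that, of "\<ominus>\<^bsub>R\<^esub> \<one>\<^bsub>R\<^esub>"] that R.l_minus[of "\<one>\<^bsub>R\<^esub>" a] by simp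
    show "a \<oplus>\<^bsub>R\<^esub> b \<in> ?I" if ab: "a \<in> ?I" "b \<in> ?I" for a b
    proof -
      obtain h k where h: "h \<in> H" "cong_mod K h (a \<odot>\<^bsub>M\<^esub> g)" "a \<in> carrier R"
        and k: "k \<in> H" "cong_mod K k (b \<odot>\<^bsub>M\<^esub> g)" "b \<in> carrier R" using ab by auto
      have "cong_mod K (h \<oplus>\<^bsub>M\<^esub> k) ((a \<oplus>\<^bsub>R\<^esub> b) \<odot>\<^bsub>M\<^esub> g)"
        using cong_add[OF K h(2) k(2)] h k g by (simp add: smult_l_distr)
      then show ?thesis using submoduleE(5)[OF H h(1) k(1)] h k by auto
    qed
  qed auto
qed (rule R.ring_axioms)

lemma ideal_annihilator:
  assumes U: "submodule U R M" and u: "u \<in> carrier M"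
  shows "ideal (annihilator U u) R"
proof -
  have "cong_mod U \<zero>\<^bsub>M\<^esub> (c \<odot>\<^bsub>M\<^esub> u) \<longleftrightarrow> c \<odot>\<^bsub>M\<^esub> u \<in> U" if "c \<in> carrier R" for c
    using cong_sym[OF U] cong_zero_iff[of "c \<odot>\<^bsub>M\<^esub> u"] u that by auto
  then have "annihilator U u = {c \<in> carrier R. \<exists>h\<in>{\<zero>\<^bsub>M\<^esub>}. cong_mod U h (c \<odot>\<^bsub>M\<^esub> u)}"
    by (auto simp: annihilator_def)
  then show ?thesis
    using ideal_of_submodule[OF submodule_zero_set U u] by simp
qed

lemma submodule_Int:
  "submodule H R M \<Longrightarrow> submodule K R M \<Longrightarrow> submodule (H \<inter> K) R M"
  by (rule submoduleI) (use submoduleE submodule_zero in auto)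

text \<open>A submodule \<open>H\<close> of \<open>K + Rg\<close> is determined, among those containing it, by \<open>H \<inter> K\<close>
  and the ideal of coefficients of \<open>g\<close> occurring in \<open>H\<close>.\<close>

lemma acc_below_add_cyclic:
  assumes R: "noetherian_ring R" and K: "submodule K R M" and acc: "acc_below K"
    and g: "g \<in> carrier M"
  shows "acc_below ((\<lambda>c. c \<odot>\<^bsub>M\<^esub> g) ` carrier R <+>\<^bsub>M\<^esub> K)" (is "acc_below ?K'")
proof -
  interpret noetherian_ring R by (rule R)
  define I where "I H = {c \<in> carrier R. \<exists>h\<in>H. cong_mod K h (c \<odot>\<^bsub>M\<^esub> g)}" for H
  define ri where "ri = {(J, I). ideal I R \<and> ideal J R \<and> I \<subset> J}"
  define rs where "rs = {(H', H). submodule H R M \<and> submodule H' R M \<and> H \<subset> H' \<and> H' \<subseteq> K}"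
  have "wf (inv_image (ri <*lex*> rs) (\<lambda>H. (I H, H \<inter> K)))"
    using wf_ideals acc unfolding ri_def rs_def acc_below_def by (intro wf_inv_image wf_lex_prod)
  moreover have "{(H', H). submodule H R M \<and> submodule H' R M \<and> H \<subset> H' \<and> H' \<subseteq> ?K'}
      \<subseteq> inv_image (ri <*lex*> rs) (\<lambda>H. (I H, H \<inter> K))"
  proof (rule subrelI)
    fix H' H
    assume "(H', H) \<in> {(H', H). submodule H R M \<and> submodule H' R M \<and> H \<subset> H' \<and> H' \<subseteq> ?K'}"
    then have H: "submodule H R M" "submodule H' R M" and sub: "H \<subset> H'" "H' \<subseteq> ?K'" by auto
    have ideals: "ideal (I H) R" "ideal (I H') R"
      unfolding I_def using ideal_of_submodule[OF _ K g] H by auto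
    have le: "I H \<subseteq> I H'" using sub(1) by (auto simp: I_def)
    have "\<not> H' \<inter> K \<subseteq> H \<inter> K" if eq: "I H' \<subseteq> I H"
    proof
      assume le: "H' \<inter> K \<subseteq> H \<inter> K"
      \<comment> \<open>Modulo K, both x and some h in H equal the same multiple cg, so x - h lies
        in H' and in K, hence in H.\<close>
      have "x \<in> H" if x: "x \<in> H'" for x
      proof -
        obtain c where c: "c \<in> carrier R" "cong_mod K x (c \<odot>\<^bsub>M\<^esub> g)"
          using x sub(2) mem_add_cyclic_iff[OF K g] by auto
        then have "c \<in> I H'" using x by (auto simp: I_def)
        then obtain h where h: "h \<in> H" "cong_mod K h (c \<odot>\<^bsub>M\<^esub> g)" using eq by (auto simp: I_def)
        have "x \<ominus>\<^bsub>M\<^esub> h \<in> K"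
          using cong_trans[OF K c(2) cong_sym[OF K h(2)]] by (simp add: cong_mod_def)
        moreover have "x \<ominus>\<^bsub>M\<^esub> h \<in> H'"
          using submodule_diff[OF H(2)] x h(1) sub(1) by blast
        ultimately have "cong_mod H x h"
          using le cong_carrier[OF c(2)] cong_carrier[OF h(2)] by (auto simp: cong_mod_def)
        then show ?thesis using cong_mem_iff[OF H(1)] h(1) by blast
      qed
      then show False using sub(1) by blast
    qed
    then have "I H \<subset> I H' \<or> I H' = I H \<and> H \<inter> K \<subset> H' \<inter> K"
      using le sub(1) by blast
    then show "(H', H) \<in> inv_image (ri <*lex*> rs) (\<lambda>H. (I H, H \<inter> K))"
      using ideals submodule_Int[OF H(1) K] submodule_Int[OF H(2) K]
      by (simp add: ri_def rs_def)
  qed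
  ultimately show ?thesis unfolding acc_below_def by (rule wf_subset)
qed

lemma acc_below_carrier:
  assumes R: "noetherian_ring R" and fg: "fg_module R M"
  shows "acc_below (carrier M)"
proof -
  obtain A where A: "A \<subseteq> carrier M" "finite A"
      "\<And>H. submodule H R M \<Longrightarrow> A \<subseteq> H \<Longrightarrow> H = carrier M"
    using fg by (auto simp: fg_module_def)
  have "\<exists>K. submodule K R M \<and> A \<subseteq> K \<and> acc_below K"
    using A(2,1)
  proof (induction A)
    case empty
    \<comment> \<open>No strict inclusion of submodules fits below zero, so the relation is
      empty.\<close>
    have "{(H', H). submodule H R M \<and> submodule H' R M \<and> H \<subset> H' \<and> H' \<subseteq> {\<zero>\<^bsub>M\<^esub>}} = {}"
      using submodule_zero by fastforce
    then have "acc_below {\<zero>\<^bsub>M\<^esub>}" unfolding acc_below_def by (simp only: wf_on_bot)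
    then show ?case using submodule_zero_set by blast
  next
    case (insert g A)
    then obtain K where K: "submodule K R M" "A \<subseteq> K" "acc_below K" by auto
    have g: "g \<in> carrier M" using insert by auto
    let ?K' = "(\<lambda>c. c \<odot>\<^bsub>M\<^esub> g) ` carrier R <+>\<^bsub>M\<^esub> K"
    have "insert g A \<subseteq> ?K'" using subset_add_cyclic[OF K(1) g] K(2) by blast
    then show ?case
      using acc_below_add_cyclic[OF R K(1,3) g] submodule_set_add[OF K(1) submodule_cyclic[OF g]]
      by blast
  qed
  then show ?thesis using A(3) by blast
qed

definition associated_primes :: "'c set \<Rightarrow> 'a set set" where
  "associated_primes U = {annihilator U u | u. u \<in> carrier M - U \<and> primeideal (annihilator U u) R}"

text \<open>An annihilator maximal among those of nonzero classes is prime: if ab kills v but a does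
  not, the annihilator of av contains that of v, hence equals it, and it contains b.\<close>

lemma exists_associated_prime:
  assumes R: "noetherian_ring R" and U: "submodule U R M" and u: "u \<in> carrier M - U"
  shows "\<exists>P \<in> associated_primes U. annihilator U u \<subseteq> P"
proof -
  interpret noetherian_ring R by (rule R)
  define S where "S = {annihilator U v | v. v \<in> carrier M - U \<and> annihilator U u \<subseteq> annihilator U v}"
  have "S \<noteq> {}" using u by (auto simp: S_def)
  moreover have "ideal I R" if "I \<in> S" for I using that ideal_annihilator[OF U] by (auto simp: S_def)
  ultimately have "\<exists>P\<in>S. \<forall>J\<in>S. P \<subseteq> J \<longrightarrow> J = P" by (rule maximal_in_ideal_set)
  then obtain P where P: "P \<in> S" "\<And>J. J \<in> S \<Longrightarrow> P \<subseteq> J \<Longrightarrow> J = P" by auto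
  obtain v where v: "v \<in> carrier M" "v \<notin> U" "annihilator U u \<subseteq> annihilator U v" "P = annihilator U v"
    using P(1) by (auto simp: S_def)
  have "primeideal (annihilator U v) R"
  proof (rule primeidealI)
    show "ideal (annihilator U v) R" using ideal_annihilator[OF U v(1)] .
    show "carrier R \<noteq> annihilator U v"
    proof
      assume "carrier R = annihilator U v"
      then have "\<one>\<^bsub>R\<^esub> \<in> annihilator U v" using R.one_closed by simp
      then show False using v(1,2) by (simp add: annihilator_def)
    qed
    show "a \<in> annihilator U v \<or> b \<in> annihilator U v"
      if ab: "a \<in> carrier R" "b \<in> carrier R" "a \<otimes>\<^bsub>R\<^esub> b \<in> annihilator U v" for a b
    proof (cases "a \<in> annihilator U v")
      case False
      have le: "annihilator U v \<subseteq> annihilator U (a \<odot>\<^bsub>M\<^esub> v)"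
        using v(1) submoduleE(4)[OF U ab(1)] smult_left_commute[OF _ ab(1) v(1)]
        by (auto simp: annihilator_def)
      then have "annihilator U (a \<odot>\<^bsub>M\<^esub> v) \<in> S"
        using False ab(1) v by (auto simp: S_def annihilator_def)
      then have "annihilator U (a \<odot>\<^bsub>M\<^esub> v) = annihilator U v" using P(2) le v(4) by blast
      moreover have "b \<in> annihilator U (a \<odot>\<^bsub>M\<^esub> v)"
        using ab v(1) smult_assoc1[of b a v] R.m_comm[of a b] by (simp add: annihilator_def)
      ultimately show ?thesis by blast
    qed simp
  qed (rule R.is_cring)
  then show ?thesis using v by (auto simp: associated_primes_def)
qed

text \<open>This is Ass(M/U) \<subseteq> Ass(V/U) \<union> Ass(M/V) for V = U + Rg. Here V/U is
  isomorphic to R/Q with Q the prime annihilator of g, and every nonzero element of R/Q has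
  annihilator Q.\<close>

lemma associated_prime_cases:
  assumes U: "submodule U R M" and g: "g \<in> carrier M"
    and Q: "primeideal (annihilator U g) R" and P: "P \<in> associated_primes U"
  shows "P = annihilator U g \<or> P \<in> associated_primes ((\<lambda>c. c \<odot>\<^bsub>M\<^esub> g) ` carrier R <+>\<^bsub>M\<^esub> U)"
    (is "_ \<or> P \<in> associated_primes ?V")
proof -
  obtain u where u: "u \<in> carrier M" "u \<notin> U" "primeideal P R" "P = annihilator U u"
    using P by (auto simp: associated_primes_def)
  note prime = primeideal.I_prime
  note mem = mem_add_cyclic_iff[OF U g]
  have UV: "U \<subseteq> ?V" using subset_add_cyclic[OF U g] by simp
  show ?thesis
  \<comment> \<open>Either a multiple ru with r outside P lands in V, and its annihilator is both P
    and that of g, or u keeps the annihilator P in M/V.\<close>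
  proof (cases "\<exists>r \<in> carrier R. r \<notin> P \<and> r \<odot>\<^bsub>M\<^esub> u \<in> ?V")
    case True
    then obtain r c where r: "r \<in> carrier R" "r \<notin> P" and c: "c \<in> carrier R"
      and rc: "cong_mod U (r \<odot>\<^bsub>M\<^esub> u) (c \<odot>\<^bsub>M\<^esub> g)" using mem by auto
    have iff: "d \<odot>\<^bsub>M\<^esub> (r \<odot>\<^bsub>M\<^esub> u) \<in> U \<longleftrightarrow> d \<odot>\<^bsub>M\<^esub> (c \<odot>\<^bsub>M\<^esub> g) \<in> U" if "d \<in> carrier R" for d
      by (rule cong_mem_iff[OF U cong_smult[OF U that rc]])
    have cU: "c \<notin> annihilator U g"
      using r u(1) c g iff[of "\<one>\<^bsub>R\<^esub>"] u(4) by (simp add: annihilator_def)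
    have "d \<in> P \<longleftrightarrow> d \<in> annihilator U g" if d: "d \<in> carrier R" for d
    proof -
      have "d \<in> P \<longleftrightarrow> d \<otimes>\<^bsub>R\<^esub> r \<in> P"
        using d r prime[OF u(3) d r(1)] ideal.I_r_closed[of P R d r] u(3)
        by (auto simp: primeideal_def)
      also have "\<dots> \<longleftrightarrow> d \<otimes>\<^bsub>R\<^esub> c \<in> annihilator U g"
        using iff[OF d] u(1,4) d r(1) c g by (simp add: annihilator_def smult_assoc1)
      also have "\<dots> \<longleftrightarrow> d \<in> annihilator U g"
        using d cU prime[OF Q d c] ideal.I_r_closed[of "annihilator U g" R d c] Q c
        by (auto simp: primeideal_def)
      finally show ?thesis .
    qed
    moreover have "P \<subseteq> carrier R" "annihilator U g \<subseteq> carrier R"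
      using u(4) by (auto simp: annihilator_def)
    ultimately show ?thesis by blast
  next
    case False
    then have "annihilator ?V u = P"
      using u(4) UV by (auto simp: annihilator_def)
    moreover have "u \<notin> ?V"
      using False u(1,2,4) R.one_closed by (force simp: annihilator_def)
    ultimately show ?thesis
      using u(1,3) by (auto simp: associated_primes_def)
  qed
qed

text \<open>Noetherian induction towards larger U: unless U is everything there is a class g with
  prime annihilator, and passing to U + Rg loses at most that one prime.\<close>

lemma finite_associated_primes:
  assumes R: "noetherian_ring R" and fg: "fg_module R M" and U: "submodule U R M"
  shows "finite (associated_primes U)"
proof -
  have wf: "wf {(H', H). submodule H R M \<and> submodule H' R M \<and> H \<subset> H' \<and> H' \<subseteq> carrier M}"
    using acc_below_carrier[OF R fg] by (simp add: acc_below_def)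
  show ?thesis
    using U
  proof (induction U rule: wf_induct_rule[OF wf])
    case (1 U)
    show ?case
    proof (cases "U = carrier M")
      case True
      then have "associated_primes U = {}" by (auto simp: associated_primes_def)
      then show ?thesis by simp
    next
      case False
      then obtain u where "u \<in> carrier M - U" using submoduleE(1)[OF 1(2)] by blast
      then obtain P where "P \<in> associated_primes U"
        using exists_associated_prime[OF R 1(2)] by blast
      then obtain g where g: "g \<in> carrier M" "g \<notin> U" "primeideal (annihilator U g) R"
        by (auto simp: associated_primes_def)
      let ?V = "(\<lambda>c. c \<odot>\<^bsub>M\<^esub> g) ` carrier R <+>\<^bsub>M\<^esub> U"
      have V: "submodule ?V R M" by (rule submodule_set_add[OF 1(2) submodule_cyclic[OF g(1)]])
      have "insert g U \<subseteq> ?V" by (rule subset_add_cyclic[OF 1(2) g(1)])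
      then have "finite (associated_primes ?V)"
        using 1 V g(2) submoduleE(1)[OF V] by blast
      then show ?thesis
        using associated_prime_cases[OF 1(2) g(1,3)] finite_subset[of _ "insert (annihilator U g) (associated_primes ?V)"]
        by blast
    qed
  qed
qed

lemma regular_mod_if_notin_associated_primes:
  assumes R: "noetherian_ring R" and U: "submodule U R M"
    and a: "a \<in> carrier R" "a \<notin> \<Union>(associated_primes U)"
  shows "regular_mod U a"
  unfolding regular_mod_def
proof (intro ballI impI, rule ccontr)
  fix u assume u: "u \<in> carrier M" "a \<odot>\<^bsub>M\<^esub> u \<in> U" "u \<notin> U"
  then have "a \<in> annihilator U u" using a(1) by (simp add: annihilator_def)
  then show False using exists_associated_prime[OF R U] u a(2) by blast
qed

text \<open>Every associated prime is the annihilator of a nonzero class, so by the trivial socle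
  none of them contains I; the finite set of associated primes then witnesses genericity.\<close>

lemma generic_regular_mod:
  assumes R: "noetherian_ring R" and fg: "fg_module R M" and U: "submodule U R M"
    and soc: "trivial_socle I U"
  shows "R.generic I (regular_mod U)"
  unfolding R.generic_def
proof (intro exI conjI ballI impI)
  show "finite (associated_primes U)" by (rule finite_associated_primes[OF R fg U])
  fix P assume "P \<in> associated_primes U"
  then show "primeideal P R" "\<not> I \<subseteq> P"
    using soc by (auto simp: associated_primes_def annihilator_def trivial_socle_def)
next
  fix a assume "a \<in> carrier R" "\<forall>P\<in>associated_primes U. a \<notin> P"
  then show "regular_mod U a"
    using regular_mod_if_notin_associated_primes[OF R U] by blast
qed

text \<open>Independence of the depth of the choice of a first element: if \<open>b\<close> is the given first element,
  pass from \<open>b\<close> to \<open>a\<close> through a common regular element \<open>c\<close> of \<open>M/U\<close>, \<open>M/(U + aM)\<close> and \<open>M/(U + bM)\<close>.\<close>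

lemma deep_mod_add_multiples:
  assumes R: "noetherian_ring R" and fg: "fg_module R M" and I: "ideal I R"
  shows "\<lbrakk>submodule U R M; deep_mod I (Suc n) U; a \<in> I; regular_mod U a\<rbrakk>
    \<Longrightarrow> deep_mod I n (add_multiples a U)"
proof (induction n arbitrary: U a)
  case (Suc n)
  note U = Suc.prems(1)
  have IR: "I \<subseteq> carrier R" using ideal.Icarr[OF I] by blast
  obtain b where b: "b \<in> I" "regular_mod U b" "deep_mod I (Suc n) (add_multiples b U)"
    using Suc.prems(2) by auto
  have aR: "a \<in> carrier R" and bR: "b \<in> carrier R" using IR b(1) Suc.prems(3) by auto
  let ?Ua = "add_multiples a U" and ?Ub = "add_multiples b U"
  have Ua: "submodule ?Ua R M" and Ub: "submodule ?Ub R M"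
    using submodule_add_multiples aR bR U by auto
  have soc: "trivial_socle I ?Ub" using trivial_socle_if_deep[OF b(3)] .
  \<comment> \<open>Nothing is known yet about regular elements on M/(U + aM); the exchange imports
    the trivial socle from M/(U + bM), where the given sequence continues.\<close>
  have soca: "trivial_socle I ?Ua"
    using trivial_socle_exchange[OF U IR Suc.prems(3) b(1) Suc.prems(4) b(2) soc] .
  have socU: "trivial_socle I U" using trivial_socle_if_regular[OF b(1,2)] .
  note gen = generic_regular_mod[OF R fg]
  obtain c where c: "c \<in> I" and reg: "regular_mod U c" "regular_mod ?Ua c" "regular_mod ?Ub c"
    using R.generic_ex[OF R.generic_conj[OF gen[OF U socU]
        R.generic_conj[OF gen[OF Ua soca] gen[OF Ub soc]]] I] by auto
  have cR: "c \<in> carrier R" using c IR by auto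
  let ?Uc = "add_multiples c U"
  have Uc: "submodule ?Uc R M" using submodule_add_multiples cR U by auto
  \<comment> \<open>The induction hypothesis serves twice: at U + bM dividing by c, and then at U +
    cM dividing by a. In between, b becomes the first element of a sequence on M/(U + cM).\<close>
  have "deep_mod I n (add_multiples b ?Uc)"
    using Suc.IH[OF Ub b(3) c reg(3)] add_multiples_commute[OF bR cR U] by simp
  then have "deep_mod I (Suc n) ?Uc"
    using b(1) regular_mod_swap[OF U bR cR b(2) reg(3)] by auto
  moreover have "regular_mod ?Uc a"
    using regular_mod_swap[OF U aR cR Suc.prems(4) reg(2)] .
  ultimately have "deep_mod I n (add_multiples c ?Ua)"
    using Suc.IH[OF Uc _ Suc.prems(3)] add_multiples_commute[OF aR cR U] by simp
  then show ?case using c reg(2) by auto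
qed simp

end

section \<open>Weakly regular sequences\<close>

text \<open>Properness of \<open>seq_smult M xs\<close> is dropped: on the zero module not even the
  empty sequence is regular, although its depth is infinite.\<close>

definition weakly_regular_seq :: "('a, 'm, 'c) module_scheme \<Rightarrow> 'a list \<Rightarrow> bool" where
  "weakly_regular_seq M xs \<longleftrightarrow>
     (\<forall>i < length xs. \<forall>u \<in> carrier M.
        (xs ! i) \<odot>\<^bsub>M\<^esub> u \<in> seq_smult M (take i xs) \<longrightarrow> u \<in> seq_smult M (take i xs))"

lemma regular_seq_iff:
  "regular_seq M xs \<longleftrightarrow> weakly_regular_seq M xs \<and> seq_smult M xs \<noteq> carrier M"
  by (simp add: regular_seq_def weakly_regular_seq_def)

lemma weakly_regular_append: "weakly_regular_seq M (xs @ ys) \<Longrightarrow> weakly_regular_seq M xs"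
  unfolding weakly_regular_seq_def
proof (intro allI ballI impI)
  fix i u
  assume "\<forall>i<length (xs @ ys). \<forall>u\<in>carrier M.
      (xs @ ys) ! i \<odot>\<^bsub>M\<^esub> u \<in> seq_smult M (take i (xs @ ys)) \<longrightarrow> u \<in> seq_smult M (take i (xs @ ys))"
    and "i < length xs" "u \<in> carrier M" "xs ! i \<odot>\<^bsub>M\<^esub> u \<in> seq_smult M (take i xs)"
  then show "u \<in> seq_smult M (take i xs)"
    by (auto simp: nth_append dest!: spec[of _ i])
qed

lemma le_depth:
  "set xs \<subseteq> I \<Longrightarrow> regular_seq M xs \<Longrightarrow> enat (length xs) \<le> depth I M"
  unfolding depth_def by (auto intro!: Sup_upper)

context module
begin

lemma seq_smult_Cons: "seq_smult M (x # xs) = add_multiples x (seq_smult M xs)"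
  by (simp add: add_multiples_def)

lemma submodule_seq_smult: "set xs \<subseteq> carrier R \<Longrightarrow> submodule (seq_smult M xs) R M"
  by (induction xs)
    (simp_all add: submodule_zero_set submodule_add_multiples seq_smult_Cons del: seq_smult.simps(2))

text \<open>\<open>seq_smult\<close> recurses on the head, whereas sequences are extended at the
  end; commuting multiples moves the last element outside.\<close>

lemma seq_smult_snoc:
  "set xs \<subseteq> carrier R \<Longrightarrow> a \<in> carrier R \<Longrightarrow>
    seq_smult M (xs @ [a]) = add_multiples a (seq_smult M xs)"
proof (induction xs)
  case (Cons x xs)
  then show ?case
    using add_multiples_commute[of x a "seq_smult M xs"] submodule_seq_smult[of xs]
    by (simp only: append_Cons seq_smult_Cons set_simps insert_subset)
qed (simp add: add_multiples_def)

lemma weakly_regular_snoc: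
  "weakly_regular_seq M (xs @ [a]) \<longleftrightarrow> weakly_regular_seq M xs \<and> regular_mod (seq_smult M xs) a"
  by (auto simp: weakly_regular_seq_def regular_mod_def less_Suc_eq nth_append)

lemma add_multiples_carrier: "a \<in> carrier R \<Longrightarrow> add_multiples a (carrier M) = carrier M"
proof (intro equalityI subsetI)
  fix x assume a: "a \<in> carrier R" and "x \<in> carrier M"
  then have "cong_mod (carrier M) x (a \<odot>\<^bsub>M\<^esub> \<zero>\<^bsub>M\<^esub>)"
    by (simp add: cong_zero_iff)
  then show "x \<in> add_multiples a (carrier M)"
    using mem_add_multiples_iff[OF a carrier_is_submodule] M.zero_closed by blast
qed (use submoduleE(1)[OF submodule_add_multiples[OF _ carrier_is_submodule]] in blast)

text \<open>The quotient M/M is zero, and everything is regular on it. This matches the convention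
  that the zero module has infinite depth.\<close>

lemma deep_mod_carrier:
  assumes "I \<subseteq> carrier R" "I \<noteq> {}"
  shows "deep_mod I n (carrier M)"
proof (induction n)
  case (Suc n)
  obtain a where "a \<in> I" using assms(2) by blast
  moreover from this have "add_multiples a (carrier M) = carrier M"
    using add_multiples_carrier assms(1) by blast
  ultimately show ?case using Suc by (auto simp: regular_mod_def intro!: bexI[of _ a])
qed simp

lemma deep_mod_mono: "deep_mod I n U \<Longrightarrow> k \<le> n \<Longrightarrow> deep_mod I k U"
proof (induction n arbitrary: U k)
  case (Suc n)
  then show ?case by (cases k) auto
qed simp

text \<open>The list is split into a prefix already divided out and a rest still to be used, as the
  recursion of \<open>deep_mod\<close> demands.\<close>

lemma deep_mod_if_weakly_regular:
  assumes I: "I \<subseteq> carrier R"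
  shows "set xs \<subseteq> I \<Longrightarrow> set ys \<subseteq> I \<Longrightarrow> weakly_regular_seq M (xs @ ys) \<Longrightarrow>
    deep_mod I (length ys) (seq_smult M xs)"
proof (induction ys arbitrary: xs)
  case (Cons y ys)
  have "xs @ y # ys = (xs @ [y]) @ ys" by simp
  then have w: "weakly_regular_seq M ((xs @ [y]) @ ys)" using Cons.prems(3) by simp
  have "set xs \<subseteq> carrier R" "y \<in> carrier R" using Cons.prems I by auto
  then have "deep_mod I (length ys) (add_multiples y (seq_smult M xs))"
    using Cons.IH[of "xs @ [y]"] Cons.prems(1,2) w by (simp add: seq_smult_snoc)
  moreover have "regular_mod (seq_smult M xs) y"
    using weakly_regular_append[OF w] by (simp add: weakly_regular_snoc)
  ultimately show ?case using Cons.prems(2) by auto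
qed simp

lemma deep_mod_if_le_depth:
  assumes I: "I \<subseteq> carrier R" "I \<noteq> {}" and d: "enat n \<le> depth I M"
  shows "deep_mod I n {\<zero>\<^bsub>M\<^esub>}"
proof (cases "carrier M = {\<zero>\<^bsub>M\<^esub>} \<or> n = 0")
  case True
  then show ?thesis using deep_mod_carrier[OF I, of n] by auto
next
  case False
  have "\<exists>xs. set xs \<subseteq> I \<and> regular_seq M xs \<and> n \<le> length xs"
  proof (rule ccontr)
    assume n: "\<not> ?thesis"
    \<comment> \<open>Here n is positive, so lengths below n are bounded by n - 1 and so is their
      supremum; this avoids asking whether the supremum is attained.\<close>
    have "depth I M \<le> enat (n - 1)"
      using False n by (auto simp: depth_def not_le intro!: Sup_least)
    then have "enat n \<le> enat (n - 1)" using d order_trans by blast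
    then show False using False by auto
  qed
  then obtain xs where xs: "set xs \<subseteq> I" "weakly_regular_seq M xs" "n \<le> length xs"
    by (auto simp: regular_seq_iff)
  then show ?thesis
    using deep_mod_mono deep_mod_if_weakly_regular[OF I(1), of "[]" xs] by auto
qed

text \<open>Each element of xs uses up at most one unit of the available length, so n units remain
  whichever xs was chosen.\<close>

lemma deep_mod_after_weakly_regular:
  assumes R: "noetherian_ring R" and fg: "fg_module R M" and I: "ideal I R"
  shows "set xs \<subseteq> I \<Longrightarrow> weakly_regular_seq M xs \<Longrightarrow> deep_mod I (length xs + n) {\<zero>\<^bsub>M\<^esub>} \<Longrightarrow>
    deep_mod I n (seq_smult M xs)"
proof (induction xs arbitrary: n rule: rev_induct)
  case (snoc x xs)
  have c: "set xs \<subseteq> carrier R" "x \<in> carrier R" "x \<in> I"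
    using snoc.prems(1) ideal.Icarr[OF I] by auto
  have "deep_mod I (Suc n) (seq_smult M xs)"
    using snoc.IH[of "Suc n"] snoc.prems by (simp add: weakly_regular_snoc)
  then show ?case
    using deep_mod_add_multiples[OF R fg I submodule_seq_smult[OF c(1)] _ c(3)] snoc.prems(2)
    by (simp add: weakly_regular_snoc seq_smult_snoc c)
qed simp

lemma generic_weakly_regular_if_trivial_socle:
  assumes R: "noetherian_ring R" and fg: "fg_module R M" and xs: "set xs \<subseteq> carrier R"
    and reg: "weakly_regular_seq M xs" and soc: "trivial_socle I (seq_smult M xs)"
  shows "R.generic I (\<lambda>a. weakly_regular_seq M (xs @ [a]))"
  using generic_regular_mod[OF R fg submodule_seq_smult[OF xs] soc] reg
  by (simp add: weakly_regular_snoc)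

text \<open>One unit of depth is left after xs, so the socle modulo xs is trivial and the next
  element can be taken generically.\<close>

lemma generic_weakly_regular_if_less_depth:
  assumes R: "noetherian_ring R" and fg: "fg_module R M" and I: "ideal I R"
    and xs: "set xs \<subseteq> I" "weakly_regular_seq M xs" and d: "enat (Suc (length xs)) \<le> depth I M"
  shows "R.generic I (\<lambda>a. weakly_regular_seq M (xs @ [a]))"
proof -
  have IR: "I \<subseteq> carrier R" "I \<noteq> {}"
    using ideal.Icarr[OF I] additive_subgroup.zero_closed[of I R] I by (auto simp: ideal_def)
  have "deep_mod I 1 (seq_smult M xs)"
    using deep_mod_after_weakly_regular[OF R fg I xs, of 1] deep_mod_if_le_depth[OF IR d] by simp
  then have "trivial_socle I (seq_smult M xs)"
    using trivial_socle_if_deep[of I 0] by simp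
  then show ?thesis
    using generic_weakly_regular_if_trivial_socle[OF R fg _ xs(2)] xs(1) IR(1) by blast
qed

end

section \<open>The ring as a module over itself\<close>

lemma regular_module_simps [simp]:
  "carrier (regular_module R) = carrier R" "zero (regular_module R) = zero R"
  "add (regular_module R) = add R" "smult (regular_module R) = monoid.mult R"
  by (simp_all add: regular_module_def)

context cring
begin

lemma module_regular_module: "module R (regular_module R)"
proof (rule moduleI)
  show "abelian_group (regular_module R)"
  proof (rule abelian_groupI)
    fix x assume "x \<in> carrier (regular_module R)"
    then show "\<exists>y\<in>carrier (regular_module R). y \<oplus>\<^bsub>regular_module R\<^esub> x = \<zero>\<^bsub>regular_module R\<^esub>"
      using l_neg[of x] by auto
  qed (auto simp: a_assoc intro: a_comm)
qed (auto simp: is_cring l_distr r_distr m_assoc)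

lemma submodule_regular_module_iff: "submodule H R (regular_module R) \<longleftrightarrow> ideal H R"
proof
  interpret M: module R "regular_module R" by (rule module_regular_module)
  have minus: "\<ominus>\<^bsub>regular_module R\<^esub> x = \<ominus> x" for x
    by (simp add: a_inv_def m_inv_def)
  {
    assume H: "submodule H R (regular_module R)"
    note HE = M.submoduleE[OF H]
    have l: "x \<otimes> a \<in> H" if "a \<in> H" "x \<in> carrier R" for a x
      using HE(4)[OF that(2,1)] by simp
    show "ideal H R"
    proof (rule idealI)
      show "subgroup H (add_monoid R)"
        using HE(1,2) HE(3)[unfolded minus] HE(5)
        by (intro add.subgroupI) (simp_all add: a_inv_def[symmetric])
      show "a \<otimes> x \<in> H" if "a \<in> H" "x \<in> carrier R" for a x
        using l[OF that] HE(1) that by (simp add: m_comm[of a x] subset_iff)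
    qed (rule ring_axioms, rule l)
  }
  {
    assume H: "ideal H R"
    interpret H: ideal H R by (rule H)
    show "submodule H R (regular_module R)"
      by (rule M.submoduleI) (simp_all add: minus H.I_l_closed H.a_subset)
  }
qed

lemma fg_regular_module: "fg_module R (regular_module R)"
  unfolding fg_module_def
proof (intro conjI exI[of _ "{\<one>}"] allI impI)
  fix H assume "submodule H R (regular_module R)" "{\<one>} \<subseteq> H"
  then show "H = carrier (regular_module R)"
    using ideal.one_imp_carrier[of H R] by (simp add: submodule_regular_module_iff)
qed (auto simp: module_regular_module)

end

section \<open>A socle element modulo a common weakly regular sequence\<close>

context noetherian_local_ring
begin

lemma seq_smult_subset_max_ideal:
  "set xs \<subseteq> \<mm> \<Longrightarrow> seq_smult (regular_module R) xs \<subseteq> \<mm>"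
proof (induction xs)
  case Nil
  show ?case using max_ideal additive_subgroup.zero_closed[of \<mm> R]
    by (auto simp: maximalideal_def ideal_def)
next
  case (Cons x xs)
  interpret m: ideal \<mm> R using max_ideal by (simp add: maximalideal_def)
  have "x \<in> \<mm>" using Cons.prems by simp
  then show ?case
    using Cons m.I_r_closed by (auto simp: set_add_defs intro!: m.a_closed)
qed

text \<open>Take \<open>xs\<close> with \<open>xR\<close> maximal. If there were no such \<open>s\<close>, then \<open>R/xR\<close> would have
  trivial socle, so the depth of \<open>R\<close>, hence of all three modules, would exceed the length of \<open>xs\<close>, and
  prime avoidance would extend \<open>xs\<close>.\<close>

lemma exists_socle_element_mod_weakly_regular:
  assumes X: "Deep R \<mm> X" and Y: "Deep R \<mm> Y" and Z: "Deep R \<mm> Z"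
  shows "\<exists>xs s. set xs \<subseteq> \<mm> \<and> weakly_regular_seq X xs \<and> weakly_regular_seq Y xs \<and>
    weakly_regular_seq Z xs \<and> s \<in> carrier R \<and> s \<notin> seq_smult (regular_module R) xs \<and>
    (\<forall>c\<in>\<mm>. c \<otimes> s \<in> seq_smult (regular_module R) xs)"
proof -
  let ?R = "regular_module R"
  interpret m: ideal \<mm> R using max_ideal by (simp add: maximalideal_def)
  interpret RM: module R ?R by (rule module_regular_module)
  have R: "noetherian_ring R" by (rule noetherian_ring_axioms)
  have fg: "fg_module R X" "fg_module R Y" "fg_module R Z"
    and depth: "depth \<mm> ?R \<le> depth \<mm> X" "depth \<mm> ?R \<le> depth \<mm> Y" "depth \<mm> ?R \<le> depth \<mm> Z"
    using X Y Z by (auto simp: Deep_def)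
  have mod: "module R X" "module R Y" "module R Z" using fg by (auto simp: fg_module_def)
  \<comment> \<open>R is included among the modules because the length of xs is to be compared with
    the depth of R.\<close>
  define T where "T = {xs. set xs \<subseteq> \<mm> \<and> weakly_regular_seq ?R xs \<and> weakly_regular_seq X xs \<and>
    weakly_regular_seq Y xs \<and> weakly_regular_seq Z xs}"
  have "[] \<in> T" by (simp add: T_def weakly_regular_seq_def)
  then have "seq_smult ?R ` T \<noteq> {}" by blast
  moreover have "ideal I R" if "I \<in> seq_smult ?R ` T" for I
    using that RM.submodule_seq_smult max_ideal_subset
    by (auto simp: T_def submodule_regular_module_iff[symmetric])
  ultimately have "\<exists>I\<in>seq_smult ?R ` T. \<forall>J\<in>seq_smult ?R ` T. I \<subseteq> J \<longrightarrow> J = I"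
    by (rule maximal_in_ideal_set)
  then obtain I where I: "I \<in> seq_smult ?R ` T" "\<forall>J\<in>seq_smult ?R ` T. I \<subseteq> J \<longrightarrow> J = I" ..
  then obtain xs where xs: "xs \<in> T" "I = seq_smult ?R xs" by blast
  then have sub: "set xs \<subseteq> \<mm>" and w: "weakly_regular_seq ?R xs" "weakly_regular_seq X xs"
    "weakly_regular_seq Y xs" "weakly_regular_seq Z xs" by (auto simp: T_def)
  have subR: "set xs \<subseteq> carrier R" using sub max_ideal_subset by blast
  have "\<not> RM.trivial_socle \<mm> (seq_smult ?R xs)"
  proof
    assume soc: "RM.trivial_socle \<mm> (seq_smult ?R xs)"
    have gen: "generic \<mm> (\<lambda>a. weakly_regular_seq ?R (xs @ [a]))"
      by (rule RM.generic_weakly_regular_if_trivial_socle[OF R fg_regular_module subR w(1) soc])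
    obtain c where c: "c \<in> \<mm>" "weakly_regular_seq ?R (xs @ [c])"
      using generic_ex[OF gen m.is_ideal] by blast
    \<comment> \<open>Inside \<mm> properness is automatic, so this weakly regular sequence is
      regular and bounds the depth of R from below.\<close>
    have "seq_smult ?R (xs @ [c]) \<noteq> carrier R"
      using seq_smult_subset_max_ideal[of "xs @ [c]"] sub c(1) one_notin_max_ideal by auto
    then have "regular_seq ?R (xs @ [c])"
      using c(2) by (simp add: regular_seq_iff)
    then have d: "enat (Suc (length xs)) \<le> depth \<mm> ?R"
      using le_depth[of "xs @ [c]" \<mm> ?R] c(1) sub by simp
    \<comment> \<open>c was chosen for R alone, to bound its depth. The bound passes to the other
      modules through \<open>Deep\<close>, and pooling the generic conditions yields an a that works
      for all four.\<close>
    have "generic \<mm> (\<lambda>a. weakly_regular_seq X (xs @ [a]))"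
      "generic \<mm> (\<lambda>a. weakly_regular_seq Y (xs @ [a]))"
      "generic \<mm> (\<lambda>a. weakly_regular_seq Z (xs @ [a]))"
      using module.generic_weakly_regular_if_less_depth[OF _ R _ m.is_ideal sub] mod fg w(2-4)
        order_trans[OF d] depth by blast+
    note generic_ex[OF generic_conj[OF gen generic_conj[OF this(1) generic_conj[OF this(2,3)]]] m.is_ideal]
    then obtain a where a: "a \<in> \<mm>" "weakly_regular_seq ?R (xs @ [a])" "weakly_regular_seq X (xs @ [a])"
      "weakly_regular_seq Y (xs @ [a])" "weakly_regular_seq Z (xs @ [a])" by blast
    have aR: "a \<in> carrier R" using a(1) max_ideal_subset by blast
    have "xs @ [a] \<in> T"
      using a sub by (simp add: T_def)
    moreover have mem: "x \<in> seq_smult ?R (xs @ [a]) \<longleftrightarrow>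
        (\<exists>w\<in>carrier R. RM.cong_mod (seq_smult ?R xs) x (a \<otimes> w))" for x
      using RM.mem_add_multiples_iff[OF aR RM.submodule_seq_smult[OF subR]]
        RM.seq_smult_snoc[OF subR aR] by simp
    have "I \<subseteq> seq_smult ?R (xs @ [a])"
    proof
      fix x assume x: "x \<in> I"
      then have "x \<in> carrier R"
        using RM.submoduleE(1)[OF RM.submodule_seq_smult[OF subR]] xs(2) by auto
      then have "RM.cong_mod (seq_smult ?R xs) x (a \<otimes> \<zero>)"
        using x xs(2) aR RM.cong_zero_iff[of x] by simp
      then show "x \<in> seq_smult ?R (xs @ [a])" using mem by blast
    qed
    \<comment> \<open>By maximality a already lies in xR; regularity of a modulo xR then puts 1
      there, which is impossible inside \<mm>.\<close>
    ultimately have "seq_smult ?R (xs @ [a]) = seq_smult ?R xs" using I(2) xs(2) by blast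
    moreover have "RM.cong_mod (seq_smult ?R xs) a (a \<otimes> \<one>)"
      using RM.cong_refl[OF RM.submodule_seq_smult[OF subR], of a] aR by simp
    then have "a \<in> seq_smult ?R (xs @ [a])" using mem by blast
    ultimately have "a \<otimes> \<one> \<in> seq_smult ?R xs" using aR by simp
    moreover have "RM.regular_mod (seq_smult ?R xs) a"
      using a(2) RM.weakly_regular_snoc by blast
    ultimately have "\<one> \<in> seq_smult ?R xs" by (auto simp: RM.regular_mod_def)
    then show False using seq_smult_subset_max_ideal[OF sub] one_notin_max_ideal by blast
  qed
  then obtain s where "s \<in> carrier R" "s \<notin> seq_smult ?R xs" "\<forall>c\<in>\<mm>. c \<otimes> s \<in> seq_smult ?R xs"
    by (auto simp: RM.trivial_socle_def)
  then show ?thesis using sub w(2-4) by auto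
qed

end

section \<open>Homomorphisms and exact sequences\<close>

lemma mod_homD:
  assumes "f \<in> mod_hom R M N"
  shows "x \<in> carrier M \<Longrightarrow> f x \<in> carrier N"
    and "x \<in> carrier M \<Longrightarrow> y \<in> carrier M \<Longrightarrow> f (x \<oplus>\<^bsub>M\<^esub> y) = f x \<oplus>\<^bsub>N\<^esub> f y"
    and "a \<in> carrier R \<Longrightarrow> x \<in> carrier M \<Longrightarrow> f (a \<odot>\<^bsub>M\<^esub> x) = a \<odot>\<^bsub>N\<^esub> f x"
  using assms by (auto simp: mod_hom_def hom_def)

lemma mod_hom_zero:
  assumes f: "f \<in> mod_hom R M N" and M: "module R M" and N: "module R N"
  shows "f \<zero>\<^bsub>M\<^esub> = \<zero>\<^bsub>N\<^esub>"
proof -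
  interpret M: module R M by (rule M)
  interpret N: module R N by (rule N)
  have "f (\<zero>\<^bsub>R\<^esub> \<odot>\<^bsub>M\<^esub> \<zero>\<^bsub>M\<^esub>) = \<zero>\<^bsub>R\<^esub> \<odot>\<^bsub>N\<^esub> f \<zero>\<^bsub>M\<^esub>"
    by (rule mod_homD(3)[OF f M.R.zero_closed M.M.zero_closed])
  then show ?thesis using mod_homD(1)[OF f] by simp
qed

lemma mod_hom_diff:
  assumes f: "f \<in> mod_hom R M N" and M: "module R M" and N: "module R N"
    and x: "x \<in> carrier M" and y: "y \<in> carrier M"
  shows "f (x \<ominus>\<^bsub>M\<^esub> y) = f x \<ominus>\<^bsub>N\<^esub> f y"
proof -
  interpret M: module R M by (rule M)
  interpret N: module R N by (rule N)
  have fy: "f y \<in> carrier N" using mod_homD(1)[OF f y] .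
  have "f (\<ominus>\<^bsub>M\<^esub> y) = f ((\<ominus>\<^bsub>R\<^esub> \<one>\<^bsub>R\<^esub>) \<odot>\<^bsub>M\<^esub> y)"
    using y M.smult_l_minus[of "\<one>\<^bsub>R\<^esub>" y] by simp
  also have "\<dots> = (\<ominus>\<^bsub>R\<^esub> \<one>\<^bsub>R\<^esub>) \<odot>\<^bsub>N\<^esub> f y" using mod_homD(3)[OF f _ y] by simp
  also have "\<dots> = \<ominus>\<^bsub>N\<^esub> f y" using fy N.smult_l_minus[of "\<one>\<^bsub>R\<^esub>" "f y"] by simp
  finally show ?thesis using mod_homD(2)[OF f x] y by (simp add: M.minus_eq N.minus_eq)
qed

lemma (in module) seq_smult_ConsE:
  assumes "y \<in> seq_smult M (x # xs)"
  obtains u v where "u \<in> carrier M" "v \<in> seq_smult M xs" "y = x \<odot>\<^bsub>M\<^esub> u \<oplus>\<^bsub>M\<^esub> v"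
  using assms by (auto simp: set_add_def set_mult_def)

lemma (in module) seq_smult_ConsI:
  assumes "u \<in> carrier M" "v \<in> seq_smult M xs"
  shows "x \<odot>\<^bsub>M\<^esub> u \<oplus>\<^bsub>M\<^esub> v \<in> seq_smult M (x # xs)"
  using assms by (auto simp: set_add_def set_mult_def)

lemma mod_hom_seq_smult:
  assumes f: "f \<in> mod_hom R M N" and M: "module R M" and N: "module R N"
  shows "set xs \<subseteq> carrier R \<Longrightarrow> y \<in> seq_smult M xs \<Longrightarrow> f y \<in> seq_smult N xs"
proof (induction xs arbitrary: y)
  case Nil
  then show ?case by (simp add: mod_hom_zero[OF f M N])
next
  case (Cons x xs)
  interpret M: module R M by (rule M)
  interpret N: module R N by (rule N)
  obtain u v where uv: "u \<in> carrier M" "v \<in> seq_smult M xs" "y = x \<odot>\<^bsub>M\<^esub> u \<oplus>\<^bsub>M\<^esub> v"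
    using M.seq_smult_ConsE[OF Cons.prems(2)] .
  have x: "x \<in> carrier R" and sub: "set xs \<subseteq> carrier R" using Cons.prems(1) by auto
  have v: "v \<in> carrier M" using uv(2) M.submoduleE(1)[OF M.submodule_seq_smult[OF sub]] by blast
  have "f y = x \<odot>\<^bsub>N\<^esub> f u \<oplus>\<^bsub>N\<^esub> f v"
    using uv(1,3) x v by (simp add: mod_homD[OF f])
  then show ?case
    using N.seq_smult_ConsI[OF mod_homD(1)[OF f uv(1)] Cons.IH[OF sub uv(2)], of x] by simp
qed

lemma seq_smult_lift:
  assumes f: "f \<in> mod_hom R M N" and M: "module R M" and N: "module R N"
    and surj: "f ` carrier M = carrier N"
  shows "set xs \<subseteq> carrier R \<Longrightarrow> y \<in> seq_smult N xs \<Longrightarrow> \<exists>w \<in> seq_smult M xs. f w = y"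
proof (induction xs arbitrary: y)
  case Nil
  then show ?case by (simp add: mod_hom_zero[OF f M N])
next
  case (Cons x xs)
  interpret M: module R M by (rule M)
  interpret N: module R N by (rule N)
  obtain u v where uv: "u \<in> carrier N" "v \<in> seq_smult N xs" "y = x \<odot>\<^bsub>N\<^esub> u \<oplus>\<^bsub>N\<^esub> v"
    using N.seq_smult_ConsE[OF Cons.prems(2)] .
  have x: "x \<in> carrier R" and sub: "set xs \<subseteq> carrier R" using Cons.prems(1) by auto
  obtain v' where v': "v' \<in> seq_smult M xs" "f v' = v" using Cons.IH[OF sub uv(2)] by blast
  have "u \<in> f ` carrier M" using uv(1) by (simp only: surj)
  then obtain u' where u': "u' \<in> carrier M" "f u' = u" by blast
  have v: "v' \<in> carrier M" using v'(1) M.submoduleE(1)[OF M.submodule_seq_smult[OF sub]] by blast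
  have "f (x \<odot>\<^bsub>M\<^esub> u' \<oplus>\<^bsub>M\<^esub> v') = y"
    using uv(3) x v v' u' by (simp add: mod_homD[OF f])
  then show ?case
    using M.seq_smult_ConsI[OF u'(1) v'(1), of x] by blast
qed

text \<open>An elementary form of \<open>Tor\<^sub>1(N, R/xR) = 0\<close>.\<close>

lemma seq_smult_pullback:
  assumes L: "module R L" and M: "module R M" and N: "module R N"
    and exact: "short_exact R L M N f g"
  shows "set xs \<subseteq> carrier R \<Longrightarrow> weakly_regular_seq N xs \<Longrightarrow> u \<in> carrier L \<Longrightarrow>
    f u \<in> seq_smult M xs \<Longrightarrow> u \<in> seq_smult L xs"
proof (induction xs arbitrary: u rule: rev_induct)
  interpret L: module R L by (rule L)
  interpret M: module R M by (rule M)
  interpret N: module R N by (rule N)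
  have f: "f \<in> mod_hom R L M" and g: "g \<in> mod_hom R M N" and inj: "inj_on f (carrier L)"
    and ker: "f ` carrier L = a_kernel M N g" and surj: "g ` carrier M = carrier N"
    using exact by (auto simp: short_exact_def)
  {
    case Nil
    then have "f u = f \<zero>\<^bsub>L\<^esub>" using mod_hom_zero[OF f L M] by simp
    then have "u = \<zero>\<^bsub>L\<^esub>"
      by (rule inj_onD[OF inj _ Nil.prems(3) L.zero_closed])
    then show ?case by simp
  next
    case (snoc x xs)
    have x: "x \<in> carrier R" and sub: "set xs \<subseteq> carrier R" using snoc.prems(1) by auto
    note SM = M.submodule_seq_smult[OF sub] and SN = N.submodule_seq_smult[OF sub]
      and SL = L.submodule_seq_smult[OF sub]
    have wr: "weakly_regular_seq N xs" and reg: "N.regular_mod (seq_smult N xs) x"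
      using snoc.prems(2) N.weakly_regular_snoc by auto
    \<comment> \<open>Thus fu = xw modulo the earlier elements. Applying g kills fu; regularity of x
      on N and a lift along g allow w to be replaced by some f l, and then u - xl falls under the
      induction hypothesis.\<close>
    obtain w where w: "w \<in> carrier M" "M.cong_mod (seq_smult M xs) (f u) (x \<odot>\<^bsub>M\<^esub> w)"
      using snoc.prems(4) M.seq_smult_snoc[OF sub x] M.mem_add_multiples_iff[OF x SM] by auto
    have fu: "f u \<in> carrier M" using mod_homD(1)[OF f snoc.prems(3)] .
    have gfu: "g (f u) = \<zero>\<^bsub>N\<^esub>" using ker snoc.prems(3) by (auto simp: a_kernel_def')
    have "g (f u \<ominus>\<^bsub>M\<^esub> x \<odot>\<^bsub>M\<^esub> w) \<in> seq_smult N xs"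
      using w(2) mod_hom_seq_smult[OF g M N sub] by (simp add: M.cong_mod_def)
    then have "N.cong_mod (seq_smult N xs) \<zero>\<^bsub>N\<^esub> (x \<odot>\<^bsub>N\<^esub> g w)"
      using gfu mod_hom_diff[OF g M N fu] w(1) x mod_homD(1)[OF g w(1)]
      by (simp add: N.cong_mod_def mod_homD(3)[OF g])
    then have "x \<odot>\<^bsub>N\<^esub> g w \<in> seq_smult N xs"
      using N.cong_mem_iff[OF SN] N.submodule_zero[OF SN] by blast
    then have "g w \<in> seq_smult N xs"
      using reg mod_homD(1)[OF g w(1)] by (simp add: N.regular_mod_def)
    then obtain w' where w': "w' \<in> seq_smult M xs" "g w' = g w"
      using seq_smult_lift[OF g M N surj sub] by blast
    have w'c: "w' \<in> carrier M" using w'(1) M.submoduleE(1)[OF SM] by blast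
    have "g (w \<ominus>\<^bsub>M\<^esub> w') = \<zero>\<^bsub>N\<^esub>"
      using mod_hom_diff[OF g M N w(1) w'c] w'(2) mod_homD(1)[OF g w(1)] by (simp add: N.minus_self)
    then have "w \<ominus>\<^bsub>M\<^esub> w' \<in> f ` carrier L"
      using ker w(1) w'c by (simp add: a_kernel_def')
    then obtain l where l: "l \<in> carrier L" "w \<ominus>\<^bsub>M\<^esub> w' = f l" by blast
    have fl: "f l \<in> carrier M" using mod_homD(1)[OF f l(1)] .
    have wfl: "M.cong_mod (seq_smult M xs) w (f l)"
    proof -
      have "w \<ominus>\<^bsub>M\<^esub> f l = w'"
        using w(1) w'c by (simp flip: l(2) add: M.minus_eq M.minus_add M.r_neg1 M.r_neg2)
      then show ?thesis using w(1) fl w'(1) by (simp add: M.cong_mod_def)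
    qed
    have "M.cong_mod (seq_smult M xs) (f u) (x \<odot>\<^bsub>M\<^esub> f l)"
      using M.cong_trans[OF SM w(2) M.cong_smult[OF SM x wfl]] .
    then have "f (u \<ominus>\<^bsub>L\<^esub> x \<odot>\<^bsub>L\<^esub> l) \<in> seq_smult M xs"
      using mod_hom_diff[OF f L M snoc.prems(3)] mod_homD(3)[OF f x l(1)] x l(1)
      by (simp add: M.cong_mod_def)
    then have "u \<ominus>\<^bsub>L\<^esub> x \<odot>\<^bsub>L\<^esub> l \<in> seq_smult L xs"
      using snoc.IH[OF sub wr] snoc.prems(3) x l(1) by simp
    then have "L.cong_mod (seq_smult L xs) u (x \<odot>\<^bsub>L\<^esub> l)"
      using snoc.prems(3) x l(1) by (simp add: L.cong_mod_def)
    then show ?case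
      using L.seq_smult_snoc[OF sub x] L.mem_add_multiples_iff[OF x SL] l(1) by auto
  }
qed

section \<open>Finite powers of a module\<close>

lemma power_module_simps:
  "carrier (power_module M n) = ({..<n} \<rightarrow>\<^sub>E carrier M)"
  "zero (power_module M n) = (\<lambda>i\<in>{..<n}. \<zero>\<^bsub>M\<^esub>)"
  "add (power_module M n) = (\<lambda>u v. \<lambda>i\<in>{..<n}. u i \<oplus>\<^bsub>M\<^esub> v i)"
  "smult (power_module M n) = (\<lambda>a u. \<lambda>i\<in>{..<n}. a \<odot>\<^bsub>M\<^esub> u i)"
  by (simp_all add: power_module_def)

lemma power_module_coordinate:
  "x \<in> {..<n} \<rightarrow>\<^sub>E carrier M \<Longrightarrow> i < n \<Longrightarrow> x i \<in> carrier M"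
  by (simp add: PiE_iff)

lemma (in module) module_power_module: "module R (power_module M n)"
proof (rule moduleI)
  show "abelian_group (power_module M n)"
  proof (rule abelian_groupI)
    fix x assume x: "x \<in> carrier (power_module M n)"
    let ?y = "\<lambda>i\<in>{..<n}. \<ominus>\<^bsub>M\<^esub> x i"
    have "?y \<in> carrier (power_module M n)" using x by (auto simp: power_module_simps)
    moreover have "?y \<oplus>\<^bsub>power_module M n\<^esub> x = \<zero>\<^bsub>power_module M n\<^esub>"
      unfolding power_module_simps
    proof (intro restrict_ext)
      fix i assume "i \<in> {..<n}"
      then have "x i \<in> carrier M" using x by (auto simp: power_module_simps)
      then show "?y i \<oplus>\<^bsub>M\<^esub> x i = \<zero>\<^bsub>M\<^esub>" using \<open>i \<in> {..<n}\<close> by (simp add: M.l_neg)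
    qed
    ultimately show "\<exists>y\<in>carrier (power_module M n). y \<oplus>\<^bsub>power_module M n\<^esub> x = \<zero>\<^bsub>power_module M n\<^esub>"
      by (intro bexI[of _ ?y])
  next
    fix x assume x: "x \<in> carrier (power_module M n)"
    show "\<zero>\<^bsub>power_module M n\<^esub> \<oplus>\<^bsub>power_module M n\<^esub> x = x"
    proof (rule ext)
      fix i
      show "(\<zero>\<^bsub>power_module M n\<^esub> \<oplus>\<^bsub>power_module M n\<^esub> x) i = x i"
        using PiE_mem[of x "{..<n}" "\<lambda>_. carrier M" i] PiE_arb[of x "{..<n}" "\<lambda>_. carrier M" i] x
        by (simp add: power_module_simps)
    qed
  next
    fix x y assume "x \<in> carrier (power_module M n)" "y \<in> carrier (power_module M n)"
    then show "x \<oplus>\<^bsub>power_module M n\<^esub> y = y \<oplus>\<^bsub>power_module M n\<^esub> x"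
      unfolding power_module_simps by (intro restrict_ext M.a_comm) (simp_all add: power_module_coordinate)
  next
    fix x y z
    assume "x \<in> carrier (power_module M n)" "y \<in> carrier (power_module M n)"
      "z \<in> carrier (power_module M n)"
    then show "x \<oplus>\<^bsub>power_module M n\<^esub> y \<oplus>\<^bsub>power_module M n\<^esub> z =
        x \<oplus>\<^bsub>power_module M n\<^esub> (y \<oplus>\<^bsub>power_module M n\<^esub> z)"
      unfolding power_module_simps by (intro restrict_ext) (simp add: power_module_coordinate M.a_assoc)
  qed (auto simp: power_module_simps power_module_coordinate)
next
  fix x assume x: "x \<in> carrier (power_module M n)"
  show "\<one>\<^bsub>R\<^esub> \<odot>\<^bsub>power_module M n\<^esub> x = x"
    using x unfolding power_module_simps
    by (intro PiE_ext[of _ "{..<n}" "\<lambda>_. carrier M" x]) (simp_all add: power_module_coordinate)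
next
  fix a b x assume "a \<in> carrier R" "b \<in> carrier R" "x \<in> carrier (power_module M n)"
  then show "(a \<oplus>\<^bsub>R\<^esub> b) \<odot>\<^bsub>power_module M n\<^esub> x =
      a \<odot>\<^bsub>power_module M n\<^esub> x \<oplus>\<^bsub>power_module M n\<^esub> b \<odot>\<^bsub>power_module M n\<^esub> x"
    unfolding power_module_simps by (intro restrict_ext) (simp add: power_module_coordinate smult_l_distr)
next
  fix a x y
  assume "a \<in> carrier R" "x \<in> carrier (power_module M n)" "y \<in> carrier (power_module M n)"
  then show "a \<odot>\<^bsub>power_module M n\<^esub> (x \<oplus>\<^bsub>power_module M n\<^esub> y) =
      a \<odot>\<^bsub>power_module M n\<^esub> x \<oplus>\<^bsub>power_module M n\<^esub> a \<odot>\<^bsub>power_module M n\<^esub> y"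
    unfolding power_module_simps by (intro restrict_ext) (simp add: power_module_coordinate smult_r_distr)
next
  fix a b x assume "a \<in> carrier R" "b \<in> carrier R" "x \<in> carrier (power_module M n)"
  then show "(a \<otimes>\<^bsub>R\<^esub> b) \<odot>\<^bsub>power_module M n\<^esub> x =
      a \<odot>\<^bsub>power_module M n\<^esub> (b \<odot>\<^bsub>power_module M n\<^esub> x)"
    unfolding power_module_simps by (intro restrict_ext) (simp add: power_module_coordinate smult_assoc1)
qed (auto simp: power_module_simps power_module_coordinate R.is_cring)

lemma (in module) mem_seq_smult_power_module:
  shows "set xs \<subseteq> carrier R \<Longrightarrow> v \<in> carrier (power_module M n) \<Longrightarrow>
    \<forall>i<n. v i \<in> seq_smult M xs \<Longrightarrow> v \<in> seq_smult (power_module M n) xs"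
proof (induction xs arbitrary: v)
  case Nil
  then have "v = (\<lambda>i\<in>{..<n}. \<zero>\<^bsub>M\<^esub>)"
    by (intro PiE_ext[of _ "{..<n}" "\<lambda>_. carrier M"]) (auto simp: power_module_simps)
  then show ?case by (simp only: seq_smult.simps power_module_simps singleton_iff)
next
  case (Cons x xs)
  interpret P: module R "power_module M n" by (rule module_power_module)
  have sub: "set xs \<subseteq> carrier R" "x \<in> carrier R" using Cons.prems(1) by auto
  \<comment> \<open>The bound i < n sits behind the existentials so that choice yields total
    functions; \<open>restrict\<close> then turns them into tuples.\<close>
  have "\<forall>i. \<exists>u w. i < n \<longrightarrow> u \<in> carrier M \<and> w \<in> seq_smult M xs \<and> v i = x \<odot>\<^bsub>M\<^esub> u \<oplus>\<^bsub>M\<^esub> w"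
    using Cons.prems(3) seq_smult_ConsE by metis
  then obtain u w where uw: "\<And>i. i < n \<Longrightarrow> u i \<in> carrier M \<and> w i \<in> seq_smult M xs \<and>
      v i = x \<odot>\<^bsub>M\<^esub> u i \<oplus>\<^bsub>M\<^esub> w i"
    by metis
  have wM: "w i \<in> carrier M" if "i < n" for i
    using uw[OF that] submoduleE(1)[OF submodule_seq_smult[OF sub(1)]] by blast
  have u: "restrict u {..<n} \<in> carrier (power_module M n)"
    and w: "restrict w {..<n} \<in> carrier (power_module M n)"
    using uw wM by (auto simp: power_module_simps)
  have "v = x \<odot>\<^bsub>power_module M n\<^esub> restrict u {..<n} \<oplus>\<^bsub>power_module M n\<^esub> restrict w {..<n}"
    using Cons.prems(2) uw wM sub(2)
    by (intro PiE_ext[of _ "{..<n}" "\<lambda>_. carrier M"]) (auto simp: power_module_simps)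
  moreover have "restrict w {..<n} \<in> seq_smult (power_module M n) xs"
    by (rule Cons.IH[OF sub(1) w]) (simp add: uw)
  ultimately show ?case using P.seq_smult_ConsI[OF u] by metis
qed

lemma mod_hom_coordinate:
  "f \<in> mod_hom R M (power_module N n) \<Longrightarrow> i < n \<Longrightarrow> (\<lambda>u. f u i) \<in> mod_hom R M N"
  by (auto simp: mod_hom_def hom_def power_module_simps Pi_def power_module_coordinate)

section \<open>Splitting off R and the action of the socle element\<close>

context noetherian_local_ring
begin

text \<open>Scaling u gives e with f e = 1. Then c \<mapsto> ce is a section of f, and M is the
  direct sum of Re and the kernel of f.\<close>

lemma direct_summand_if_unit_value:
  assumes M: "module R M" and f: "f \<in> mod_hom R M (regular_module R)"
    and u: "u \<in> carrier M" and fu: "f u \<notin> \<mm>"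
  shows "direct_summand R (regular_module R) M"
proof -
  interpret M: module R M by (rule M)
  note RM = module_regular_module
  have fR: "f x \<in> carrier R" if "x \<in> carrier M" for x using mod_homD(1)[OF f that] by simp
  obtain b where b: "b \<in> carrier R" "b \<otimes> f u = \<one>"
    by (rule left_inverse_if_notin_max_ideal[OF fR[OF u] fu])
  define e where "e = b \<odot>\<^bsub>M\<^esub> u"
  have e: "e \<in> carrier M" and fe: "f e = \<one>"
    using b u mod_homD(3)[OF f b(1) u] by (simp_all add: e_def)
  have fce: "f (c \<odot>\<^bsub>M\<^esub> e) = c" if "c \<in> carrier R" for c
    using mod_homD(3)[OF f that e] fe that by simp
  let ?A = "(\<lambda>c. c \<odot>\<^bsub>M\<^esub> e) ` carrier R"
  define B where "B = {x \<in> carrier M. f x = \<zero>}"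
  have A: "submodule ?A R M" by (rule M.submodule_cyclic[OF e])
  have f0: "f \<zero>\<^bsub>M\<^esub> = \<zero>" using mod_hom_zero[OF f M RM] by simp
  have fsmult: "f (a \<odot>\<^bsub>M\<^esub> x) = a \<otimes> f x" if "a \<in> carrier R" "x \<in> carrier M" for a x
    using mod_homD(3)[OF f that] by simp
  have B: "submodule B R M"
  proof (rule M.submoduleI)
    show "\<ominus>\<^bsub>M\<^esub> x \<in> B" if x: "x \<in> B" for x
    proof -
      have "\<ominus>\<^bsub>M\<^esub> x = (\<ominus> \<one>) \<odot>\<^bsub>M\<^esub> x" using x M.smult_l_minus[of \<one> x] by (simp add: B_def)
      then show ?thesis using x fsmult[of "\<ominus> \<one>" x] by (simp add: B_def)
    qed
    show "x \<oplus>\<^bsub>M\<^esub> y \<in> B" if "x \<in> B" "y \<in> B" for x y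
      using that mod_homD(2)[OF f, of x y] by (simp add: B_def)
  qed (auto simp: B_def f0 fsmult)
  have "?A \<inter> B = {\<zero>\<^bsub>M\<^esub>}"
  proof
    show "?A \<inter> B \<subseteq> {\<zero>\<^bsub>M\<^esub>}" using fce e by (auto simp: B_def)
    show "{\<zero>\<^bsub>M\<^esub>} \<subseteq> ?A \<inter> B" using M.submodule_zero[OF A] M.submodule_zero[OF B] by simp
  qed
  moreover have "?A <+>\<^bsub>M\<^esub> B = carrier M"
  proof
    show "?A <+>\<^bsub>M\<^esub> B \<subseteq> carrier M" by (rule M.submoduleE(1)[OF M.submodule_set_add[OF B A]])
    show "carrier M \<subseteq> ?A <+>\<^bsub>M\<^esub> B"
    proof
      fix x assume x: "x \<in> carrier M"
      have "f (x \<ominus>\<^bsub>M\<^esub> f x \<odot>\<^bsub>M\<^esub> e) = f x \<ominus>\<^bsub>regular_module R\<^esub> f x"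
        using mod_hom_diff[OF f M RM x] fce[OF fR[OF x]] fR[OF x] e by simp
      also have "\<dots> = \<zero>" using module.minus_self[OF RM, of "f x"] fR[OF x] by simp
      finally have "M.cong_mod B x (f x \<odot>\<^bsub>M\<^esub> e)"
        using x fR[OF x] e by (simp add: M.cong_mod_def B_def)
      then show "x \<in> ?A <+>\<^bsub>M\<^esub> B"
        using M.mem_set_add_iff[OF B A] fR[OF x] by blast
    qed
  qed
  moreover have "(\<lambda>c. c \<odot>\<^bsub>M\<^esub> e) \<in> mod_iso R (regular_module R) (M\<lparr>carrier := ?A\<rparr>)"
    unfolding mod_iso_def mod_hom_def
  proof (intro CollectI conjI ballI)
    have "inj_on (\<lambda>c. c \<odot>\<^bsub>M\<^esub> e) (carrier R)" by (rule inj_on_inverseI[of _ f]) (rule fce)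
    then show "bij_betw (\<lambda>c. c \<odot>\<^bsub>M\<^esub> e) (carrier (regular_module R)) (carrier (M\<lparr>carrier := ?A\<rparr>))"
      by (simp add: bij_betw_def)
  qed (auto simp: hom_def M.smult_l_distr[OF _ _ e] M.smult_assoc1[OF _ _ e])
  ultimately show ?thesis
    unfolding direct_summand_def using A B by blast
qed

text \<open>If \<open>R\<close> is not a summand of \<open>M \<subseteq> R\<^sup>n\<close>, then \<open>M \<subseteq> \<mm>R\<^sup>n\<close>, so
  \<open>sM \<subseteq> xR\<^sup>n \<inter> M = xM\<close>.\<close>

lemma socle_annihilates_if_not_summand:
  assumes M: "module R M" and X: "module R X"
    and exact: "short_exact R M (power_module (regular_module R) n) X f g"
    and not_summand: "\<not> direct_summand R (regular_module R) M"
    and xs: "set xs \<subseteq> \<mm>" "weakly_regular_seq X xs"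
    and s: "s \<in> carrier R" "\<forall>c\<in>\<mm>. c \<otimes> s \<in> seq_smult (regular_module R) xs"
    and u: "u \<in> carrier M"
  shows "s \<odot>\<^bsub>M\<^esub> u \<in> seq_smult M xs"
proof -
  interpret RM: module R "regular_module R" by (rule module_regular_module)
  note P = RM.module_power_module[of n]
  have sub: "set xs \<subseteq> carrier R" using xs(1) max_ideal_subset by blast
  have f: "f \<in> mod_hom R M (power_module (regular_module R) n)"
    using exact by (simp add: short_exact_def)
  have fu: "f u \<in> carrier (power_module (regular_module R) n)" by (rule mod_homD(1)[OF f u])
  have su: "s \<odot>\<^bsub>M\<^esub> u \<in> carrier M" by (rule module.smult_closed[OF M s(1) u])
  have "f (s \<odot>\<^bsub>M\<^esub> u) i \<in> seq_smult (regular_module R) xs" if i: "i < n" for i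
  proof -
    have fui: "f u i \<in> carrier R"
      using power_module_coordinate[of "f u" n "regular_module R" i] fu i
      by (simp add: power_module_simps)
    \<comment> \<open>Otherwise the i-th coordinate of f takes a unit value and splits R off
      M.\<close>
    have "f u i \<in> \<mm>"
      using direct_summand_if_unit_value[OF M mod_hom_coordinate[OF f i] u] not_summand by blast
    then have "f u i \<otimes> s \<in> seq_smult (regular_module R) xs" using s(2) by blast
    moreover have "f (s \<odot>\<^bsub>M\<^esub> u) i = f u i \<otimes> s"
      using mod_homD(3)[OF mod_hom_coordinate[OF f i] s(1) u] m_comm[OF s(1) fui] by simp
    ultimately show ?thesis by simp
  qed
  then have "f (s \<odot>\<^bsub>M\<^esub> u) \<in> seq_smult (power_module (regular_module R) n) xs"
    using RM.mem_seq_smult_power_module[OF sub mod_homD(1)[OF f su]] by blast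
  then show ?thesis
    by (rule seq_smult_pullback[OF M P X exact sub xs(2) su])
qed

text \<open>If \<open>sN \<subseteq> xN\<close>, then \<open>sR \<subseteq> xN\<^sup>n \<inter> R = xR\<close>.\<close>

lemma socle_not_annihilates:
  assumes N: "module R N" and Y: "module R Y"
    and exact: "short_exact R (regular_module R) (power_module N n) Y f g"
    and xs: "set xs \<subseteq> carrier R" "weakly_regular_seq Y xs"
    and s: "s \<in> carrier R" and ann: "\<And>v. v \<in> carrier N \<Longrightarrow> s \<odot>\<^bsub>N\<^esub> v \<in> seq_smult N xs"
  shows "s \<in> seq_smult (regular_module R) xs"
proof (rule seq_smult_pullback[OF module_regular_module module.module_power_module[OF N] Y exact xs])
  have f: "f \<in> mod_hom R (regular_module R) (power_module N n)"
    using exact by (simp add: short_exact_def)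
  \<comment> \<open>R is generated by 1, so f s = s f(1), and the hypothesis on s applies to each
    coordinate of f(1).\<close>
  have "f (s \<otimes> \<one>) = s \<odot>\<^bsub>power_module N n\<^esub> f \<one>"
    using mod_homD(3)[OF f s, of \<one>] by simp
  then have fs: "f s = s \<odot>\<^bsub>power_module N n\<^esub> f \<one>" using s by simp
  have f1: "f \<one> \<in> carrier (power_module N n)" using mod_homD(1)[OF f, of \<one>] by simp
  have "f s i \<in> seq_smult N xs" if i: "i < n" for i
    using fs i ann[of "f \<one> i"] power_module_coordinate[of "f \<one>" n N i] f1
    by (simp add: power_module_simps)
  then show "f s \<in> seq_smult (power_module N n) xs"
    using module.mem_seq_smult_power_module[OF N xs(1)] mod_homD(1)[OF f, of s] s by simp
qed (simp add: s)

end

theorem theorem2p11: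
  fixes R :: "('a, 'k) ring_scheme" and \<mm> :: "'a set"
    and M :: "('a, 'm, 'c) module_scheme" and N :: "('a, 'n, 'd) module_scheme"
  assumes "noetherian_local_ring R \<mm>"
    and "fg_module R M" and "fg_module R N"
    and "Omega_Deep R \<mm> M" and "DF R \<mm> N"
  shows "((\<exists>p \<in> mod_hom R M N. p ` carrier M = carrier N)
            \<longrightarrow> direct_summand R (regular_module R) M) \<and>
         (\<forall>X :: ('a, 'x) module.
            Deep R \<mm> X \<and> (\<exists>f g. short_exact R N M X f g)
            \<longrightarrow> direct_summand R (regular_module R) M)"
proof -
  interpret noetherian_local_ring R \<mm> by (rule assms(1))
  have M: "module R M" and N: "module R N" using assms(2,3) by (auto simp: fg_module_def)
  obtain n f g and X :: "('a, (nat \<Rightarrow> 'a) set) module" where X: "Deep R \<mm> X"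
    and exX: "short_exact R M (power_module (regular_module R) n) X f g"
    using assms(4) by (auto simp: Omega_Deep_def)
  obtain n' f' g' and Y :: "('a, (nat \<Rightarrow> 'n) set) module" where Y: "Deep R \<mm> Y"
    and exY: "short_exact R (regular_module R) (power_module N n') Y f' g'"
    using assms(5) by (auto simp: DF_def)
  have mX: "module R X" and mY: "module R Y" using X Y by (auto simp: Deep_def fg_module_def)
  show ?thesis
  proof (intro conjI allI impI)
    assume "\<exists>p \<in> mod_hom R M N. p ` carrier M = carrier N"
    then obtain p where p: "p \<in> mod_hom R M N" and surj: "p ` carrier M = carrier N" by auto
    obtain xs s where xs: "set xs \<subseteq> \<mm>" "weakly_regular_seq X xs" "weakly_regular_seq Y xs"
      and s: "s \<in> carrier R" "s \<notin> seq_smult (regular_module R) xs"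
        "\<forall>c\<in>\<mm>. c \<otimes>\<^bsub>R\<^esub> s \<in> seq_smult (regular_module R) xs"
      \<comment> \<open>Only the cokernels X and Y occur in this case, so Y fills the third place as
        well.\<close>
      using exists_socle_element_mod_weakly_regular[OF X Y Y] by auto
    have sub: "set xs \<subseteq> carrier R" using xs(1) max_ideal_subset by auto
    show "direct_summand R (regular_module R) M"
    proof (rule ccontr)
      assume not_summand: "\<not> direct_summand R (regular_module R) M"
      have "s \<odot>\<^bsub>N\<^esub> v \<in> seq_smult N xs" if v: "v \<in> carrier N" for v
      proof -
        have "v \<in> p ` carrier M" using v by (simp only: surj)
        then obtain u where u: "u \<in> carrier M" "v = p u" by auto
        have "s \<odot>\<^bsub>M\<^esub> u \<in> seq_smult M xs"
          by (rule socle_annihilates_if_not_summand[OF M mX exX not_summand xs(1,2) s(1,3) u(1)])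
        then show ?thesis
          using mod_hom_seq_smult[OF p M N sub] mod_homD(3)[OF p s(1) u(1)] u(2) by force
      qed
      then show False using socle_not_annihilates[OF N mY exY sub xs(3) s(1)] s(2) by auto
    qed
  next
    fix Z :: "('a, 'x) module"
    assume "Deep R \<mm> Z \<and> (\<exists>f g. short_exact R N M Z f g)"
    then obtain h k where Z: "Deep R \<mm> Z" and exZ: "short_exact R N M Z h k" by auto
    have mZ: "module R Z" using Z by (auto simp: Deep_def fg_module_def)
    have h: "h \<in> mod_hom R N M" using exZ by (simp add: short_exact_def)
    obtain xs s where xs: "set xs \<subseteq> \<mm>" "weakly_regular_seq X xs" "weakly_regular_seq Y xs"
        "weakly_regular_seq Z xs"
      and s: "s \<in> carrier R" "s \<notin> seq_smult (regular_module R) xs"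
        "\<forall>c\<in>\<mm>. c \<otimes>\<^bsub>R\<^esub> s \<in> seq_smult (regular_module R) xs"
      using exists_socle_element_mod_weakly_regular[OF X Y Z] by auto
    have sub: "set xs \<subseteq> carrier R" using xs(1) max_ideal_subset by auto
    show "direct_summand R (regular_module R) M"
    proof (rule ccontr)
      assume not_summand: "\<not> direct_summand R (regular_module R) M"
      have "s \<odot>\<^bsub>N\<^esub> v \<in> seq_smult N xs" if v: "v \<in> carrier N" for v
      proof (rule seq_smult_pullback[OF N M mZ exZ sub xs(4)])
        show "s \<odot>\<^bsub>N\<^esub> v \<in> carrier N" by (rule module.smult_closed[OF N s(1) v])
        have "s \<odot>\<^bsub>M\<^esub> h v \<in> seq_smult M xs"
          by (rule socle_annihilates_if_not_summand[OF M mX exX not_summand xs(1,2) s(1,3)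
                mod_homD(1)[OF h v]])
        then show "h (s \<odot>\<^bsub>N\<^esub> v) \<in> seq_smult M xs" by (simp add: mod_homD(3)[OF h s(1) v])
      qed
      then show False using socle_not_annihilates[OF N mY exY sub xs(3) s(1)] s(2) by auto
    qed
  qed
qed

end
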